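(* Let $n\ge 2$ and let $T,T'$ be triangulations of $C(n+2,3)$. Then $T'$ is obtained from $T$ by a bistellar up-flip if and only if $E(\Gamma(T)) = E(\Gamma(T'))\cup\{e\}$ for some edge $e\in E(\Gamma(T))\setminus E(\Gamma(T'))$. In particular, $T\le_1 T'$ if and only if $E(\Gamma(T))\supseteq E(\Gamma(T'))$.
   Context: The cyclic polytope $C(n+2,3)$ is the convex hull of $n+2$ points on the moment curve $t\mapsto(t,t^2,t^3)$, with vertices labelled $0,\dots,n+1$ in increasing order of the parameter; simplices are identified with their vertex sets. A triangulation is a set $T$ of 3-simplices (4-element vertex subsets) whose convex hulls cover the polytope and pairwise intersect in a common (possibly empty) face; $F_1(T)$ is the set of 2-element sets contained in some simplex of $T$, and $\Gamma(T)$ is the graph $([n],F_1(T)\cap\binom{[n]}{2})$. For five vertices $v_1<v_2<v_3<v_4<v_5$ let $T_*=\{\{v_1,v_2,v_4,v_5\},\{v_1,v_2,v_3,v_4\},\{v_2,v_3,v_4,v_5\}\}$ and $T^*=\{\{v_1,v_2,v_3,v_5\},\{v_1,v_3,v_4,v_5\}\}$. If $T$ is a triangulation with $T_*\subseteq T$, then $T'=(T\setminus T_* )\cup T^*$ is a triangulation, and $T'$ is said to be obtained from $T$ by a bistellar up-flip. The first Stasheff-Tamari order is defined by $T\le_1 T'$ iff $T'$ is obtained from $T$ by a (possibly empty) finite sequence of bistellar up-flips. *)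

theory Defs
  imports "HOL-Analysis.Analysis"
begin

definition moment_pt :: "(nat \<Rightarrow> real) \<Rightarrow> nat \<Rightarrow> real^3" where
  "moment_pt t i = vector [t i, (t i)^2, (t i)^3]"

definition conv_of :: "(nat \<Rightarrow> real) \<Rightarrow> nat set \<Rightarrow> (real^3) set" where
  "conv_of t S = convex hull (moment_pt t ` S)"

definition cyclic_polytope :: "(nat \<Rightarrow> real) \<Rightarrow> nat \<Rightarrow> (real^3) set" where
  "cyclic_polytope t n = conv_of t {0..n+1}"

definition is_triangulation :: "(nat \<Rightarrow> real) \<Rightarrow> nat \<Rightarrow> nat set set \<Rightarrow> bool" where
  "is_triangulation t n T \<longleftrightarrow>
     (\<forall>S\<in>T. S \<subseteq> {0..n+1} \<and> card S = 4) \<and>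
     (\<Union>S\<in>T. conv_of t S) = cyclic_polytope t n \<and>
     (\<forall>A\<in>T. \<forall>B\<in>T. (conv_of t A \<inter> conv_of t B) face_of conv_of t A \<and>
                      (conv_of t A \<inter> conv_of t B) face_of conv_of t B)"

definition F1 :: "nat set set \<Rightarrow> nat set set" where
  "F1 T = {e. card e = 2 \<and> (\<exists>S\<in>T. e \<subseteq> S)}"

definition Gamma_edges :: "nat \<Rightarrow> nat set set \<Rightarrow> nat set set" where
  "Gamma_edges n T = {e \<in> F1 T. e \<subseteq> {1..n}}"

definition up_flip :: "(nat \<Rightarrow> real) \<Rightarrow> nat \<Rightarrow> nat set set \<Rightarrow> nat set set \<Rightarrow> bool" where
  "up_flip t n T T' \<longleftrightarrow> is_triangulation t n T \<and>
     (\<exists>v1 v2 v3 v4 v5. v1 < v2 \<and> v2 < v3 \<and> v3 < v4 \<and> v4 < v5 \<and>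
        {{v1,v2,v4,v5},{v1,v2,v3,v4},{v2,v3,v4,v5}} \<subseteq> T \<and>
        T' = (T - {{v1,v2,v4,v5},{v1,v2,v3,v4},{v2,v3,v4,v5}}) \<union> {{v1,v2,v3,v5},{v1,v3,v4,v5}})"

definition le1 :: "(nat \<Rightarrow> real) \<Rightarrow> nat \<Rightarrow> nat set set \<Rightarrow> nat set set \<Rightarrow> bool" where
  "le1 t n T T' \<longleftrightarrow> (up_flip t n)\<^sup>*\<^sup>* T T'"

end

theory Submission
  imports Defs
begin

text \<open>
  A polynomial of degree three has at most three roots, so an affine dependency of points on the
  moment curve changes sign at least four times. Hence two simplices meet improperly exactly when
  an edge \<open>xy\<close> of one pierces a triangle \<open>abc\<close> of the other, i.e. \<open>a < x < b < y < c\<close>. Since the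
  simplices cover the polytope, a pair of vertices is an edge of a triangulation iff it pierces no
  triangle of it, and the edges determine the triangulation. If the edges of \<open>T'\<close> are
  properly contained in those of \<open>T\<close>, a down-flip of \<open>T'\<close> can be found that inserts an edge of \<open>T\<close>;
  induction on the number of missing edges then connects \<open>T\<close> to \<open>T'\<close> by up-flips.
\<close>

section \<open>Affine dependencies on the moment curve\<close>

text \<open>Geometry enters through three facts only: improper intersection is piercing
  (\<open>triangulation_iff\<close>), a covered point yields a simplex with a prescribed face, and
  the lower tetrahedra of a flip cover the hull of its five vertices. The rest is order
  combinatorics on labels. The chain of flips is built backwards from \<open>T'\<close> because a
  down-flip is recognised at a single triangle \<open>v1 v3 v5\<close> with suitable apexes on both
  sides, while an up-flip from \<open>T\<close> needs three tetrahedra around one edge. The two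
  halves of a flip contain the same pairs except \<open>v2 v4\<close>, so a flip changes the edge
  set by exactly one pair. Pairs involving \<open>0\<close> or \<open>n+1\<close> can never pierce a
  triangle, so only edges inside \<open>[n]\<close> can differ.\<close>

text \<open>A cubic whose roots sit at the first sign changes of \<open>f\<close> would otherwise pair with \<open>f\<close> to a
  positive number.\<close>
lemma alternation_pos:
  fixes f t :: "nat \<Rightarrow> real"
  assumes fin: "finite V" and mono: "strict_mono_on V t"
    and cubic: "\<And>c0 c1 c2 c3. (\<Sum>i\<in>V. f i * (c0 + c1 * t i + c2 * (t i)^2 + c3 * (t i)^3)) = 0"
    and i1: "i1 \<in> V" "f i1 > 0" and first: "\<And>j. j \<in> V \<Longrightarrow> j < i1 \<Longrightarrow> f j = 0"
  obtains i2 i3 i4 i5 where "{i2,i3,i4,i5} \<subseteq> V" "i1 < i2" "i2 < i3" "i3 < i4" "i4 < i5"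
    "f i2 < 0" "f i3 > 0" "f i4 < 0" "f i5 > 0"
proof -
  have lt: "t i < t j" if "i \<in> V" "j \<in> V" "i < j" for i j
    using mono that by (auto simp: strict_mono_on_def)
  have contra: False
    if "\<And>j. j \<in> V \<Longrightarrow> f j * q (t j) \<ge> 0" "q (t i1) > 0"
       "\<And>x. q x = c0 + c1 * x + c2 * x^2 + c3 * x^3" for q c0 c1 c2 c3
  proof -
    have "(\<Sum>i\<in>V. f i * q (t i)) > 0"
      by (rule sum_pos2[OF fin i1(1)]) (use that(1,2) i1 in auto)
    moreover have "(\<Sum>i\<in>V. f i * q (t i)) = 0"
      unfolding that(3) by (rule cubic)
    ultimately show False by simp
  qed
  \<comment> \<open>Taking the least index with the next sign fixes the weak sign of
    \<open>f\<close> on the gap before it, which the later test polynomials rely on.\<close>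
  have next_index: "\<exists>k. k \<in> V \<and> i < k \<and> P k \<and> (\<forall>l\<in>V. i < l \<and> l < k \<longrightarrow> \<not> P l)"
    if "\<exists>k\<in>V. i < k \<and> P k" for i and P :: "nat \<Rightarrow> bool"
    using that LeastI_ex[of "\<lambda>k. k \<in> V \<and> i < k \<and> P k"]
      not_less_Least[of _ "\<lambda>k. k \<in> V \<and> i < k \<and> P k"] by (metis (no_types, lifting))
  \<comment> \<open>Four rounds with test polynomials of degree 0, 1, 2, 3. Each factor is written
    as root minus \<open>x\<close>, so that the polynomial is positive at
    \<open>t i1\<close>.\<close>
  have "\<exists>k\<in>V. i1 < k \<and> f k < 0"
  proof (rule ccontr)
    assume neg: "\<not> ?thesis"
    have "f j \<ge> 0" if "j \<in> V" for j
      using that neg first[of j] i1 by (metis linorder_neqE_nat less_eq_real_def not_less)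
    then show False
      by (intro contra[where q = "\<lambda>_. 1" and ?c0.0 = 1 and ?c1.0 = 0 and ?c2.0 = 0 and ?c3.0 = 0]) auto
  qed
  then obtain i2 where i2: "i2 \<in> V" "i1 < i2" "f i2 < 0"
      and n2: "\<And>l. l \<in> V \<Longrightarrow> i1 < l \<Longrightarrow> l < i2 \<Longrightarrow> f l \<ge> 0"
    using next_index[of i1 "\<lambda>k. f k < 0"] by (auto simp: not_less)
  have s2: "f j \<ge> 0" if "j \<in> V" "j < i2" for j
    using that n2[of j] first[of j] i1 by (metis linorder_neqE_nat less_eq_real_def)
  have "\<exists>k\<in>V. i2 < k \<and> f k > 0"
  proof (rule ccontr)
    assume neg: "\<not> ?thesis"
    have "f j * (t i2 - t j) \<ge> 0" if "j \<in> V" for j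
    proof -
      consider "j < i2" | "j = i2" | "i2 < j" by linarith
      then show ?thesis
      proof cases
        case 1 then show ?thesis using s2 lt[of j i2] that i2 by (simp add: mult_nonneg_nonneg)
      next
        case 3 then show ?thesis using neg lt[of i2 j] that i2
          by (intro mult_nonpos_nonpos) (auto simp: not_less)
      qed simp
    qed
    then show False
      by (rule contra[where q = "\<lambda>x. t i2 - x" and ?c0.0 = "t i2" and ?c1.0 = "-1" and ?c2.0 = 0 and ?c3.0 = 0])
        (use lt[of i1 i2] i1 i2 in auto)
  qed
  then obtain i3 where i3: "i3 \<in> V" "i2 < i3" "f i3 > 0"
      and n3: "\<And>l. l \<in> V \<Longrightarrow> i2 < l \<Longrightarrow> l < i3 \<Longrightarrow> f l \<le> 0"
    using next_index[of i2 "\<lambda>k. f k > 0"] by (auto simp: not_less)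
  have "\<exists>k\<in>V. i3 < k \<and> f k < 0"
  proof (rule ccontr)
    assume neg: "\<not> ?thesis"
    have "f j * ((t i2 - t j) * (t i3 - t j)) \<ge> 0" if "j \<in> V" for j
    proof -
      consider "j < i2" | "j = i2" | "i2 < j" "j < i3" | "j = i3" | "i3 < j" by linarith
      then show ?thesis
      proof cases
        case 1 then show ?thesis using s2 lt[of j i2] lt[of j i3] that i2 i3
          by (simp add: mult_nonneg_nonneg)
      next
        case 3 then show ?thesis using n3 lt[of i2 j] lt[of j i3] that i2 i3
          by (intro mult_nonpos_nonpos) (auto intro!: mult_nonpos_nonneg)
      next
        case 5 then show ?thesis using neg lt[of i2 j] lt[of i3 j] that i2 i3
          by (intro mult_nonneg_nonneg mult_nonpos_nonpos) (auto simp: not_less)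
      qed simp_all
    qed
    then show False
      by (rule contra[where q = "\<lambda>x. (t i2 - x) * (t i3 - x)" and ?c0.0 = "t i2 * t i3"
            and ?c1.0 = "- t i2 - t i3" and ?c2.0 = 1 and ?c3.0 = 0])
        (use lt[of i1 i2] lt[of i1 i3] i1 i2 i3 in
          \<open>simp, simp add: mult_pos_pos, simp add: algebra_simps power2_eq_square\<close>)
  qed
  then obtain i4 where i4: "i4 \<in> V" "i3 < i4" "f i4 < 0"
      and n4: "\<And>l. l \<in> V \<Longrightarrow> i3 < l \<Longrightarrow> l < i4 \<Longrightarrow> f l \<ge> 0"
    using next_index[of i3 "\<lambda>k. f k < 0"] by (auto simp: not_less)
  have "\<exists>k\<in>V. i4 < k \<and> f k > 0"
  proof (rule ccontr)
    assume neg: "\<not> ?thesis"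
    have "f j * ((t i2 - t j) * (t i3 - t j) * (t i4 - t j)) \<ge> 0" if "j \<in> V" for j
    proof -
      consider "j < i2" | "j = i2" | "i2 < j" "j < i3" | "j = i3" | "i3 < j" "j < i4"
        | "j = i4" | "i4 < j" by linarith
      then show ?thesis
      proof cases
        case 1 then show ?thesis using s2 lt[of j i2] lt[of j i3] lt[of j i4] that i2 i3 i4
          by (simp add: mult_nonneg_nonneg)
      next
        case 3 then show ?thesis using n3 lt[of i2 j] lt[of j i3] lt[of j i4] that i2 i3 i4
          by (intro mult_nonpos_nonpos mult_nonpos_nonneg) auto
      next
        case 5 then show ?thesis using n4 lt[of i2 j] lt[of i3 j] lt[of j i4] that i2 i3 i4
          by (intro mult_nonneg_nonneg mult_nonpos_nonpos) auto
      next
        case 7 then show ?thesis using neg lt[of i2 j] lt[of i3 j] lt[of i4 j] that i2 i3 i4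
          by (intro mult_nonpos_nonpos[of "f j"] mult_nonneg_nonpos mult_nonpos_nonpos)
            (auto simp: not_less)
      qed simp_all
    qed
    then show False
      by (rule contra[where q = "\<lambda>x. (t i2 - x) * (t i3 - x) * (t i4 - x)"
            and ?c0.0 = "t i2 * t i3 * t i4" and ?c1.0 = "- (t i2 * t i3 + t i2 * t i4 + t i3 * t i4)"
            and ?c2.0 = "t i2 + t i3 + t i4" and ?c3.0 = "-1"])
        (use lt[of i1 i2] lt[of i1 i3] lt[of i1 i4] i1 i2 i3 i4 in
          \<open>simp, simp add: mult_pos_pos, simp add: algebra_simps power2_eq_square power3_eq_cube\<close>)
  qed
  then show thesis using that[of i2 i3 i4] i2 i3 i4 by blast
qed

lemma alternation:
  fixes f t :: "nat \<Rightarrow> real"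
  assumes fin: "finite V" and mono: "strict_mono_on V t"
    and cubic: "\<And>c0 c1 c2 c3. (\<Sum>i\<in>V. f i * (c0 + c1 * t i + c2 * (t i)^2 + c3 * (t i)^3)) = 0"
    and nz: "\<exists>i\<in>V. f i \<noteq> 0"
  obtains i1 i2 i3 i4 i5 where "{i1,i2,i3,i4,i5} \<subseteq> V" "i1 < i2" "i2 < i3" "i3 < i4" "i4 < i5"
    "(f i1 > 0 \<and> f i2 < 0 \<and> f i3 > 0 \<and> f i4 < 0 \<and> f i5 > 0) \<or>
     (f i1 < 0 \<and> f i2 > 0 \<and> f i3 < 0 \<and> f i4 > 0 \<and> f i5 < 0)"
proof -
  define i1 where "i1 = (LEAST i. i \<in> V \<and> f i \<noteq> 0)"
  have i1: "i1 \<in> V" "f i1 \<noteq> 0"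
    unfolding i1_def using nz LeastI_ex[of "\<lambda>i. i \<in> V \<and> f i \<noteq> 0"] by blast+
  have first: "f j = 0" if "j \<in> V" "j < i1" for j
    using that not_less_Least unfolding i1_def by blast
  show thesis
  proof (cases "f i1 > 0")
    case True
    from alternation_pos[OF fin mono cubic i1(1) True first]
    obtain i2 i3 i4 i5 where "{i2,i3,i4,i5} \<subseteq> V" "i1 < i2" "i2 < i3" "i3 < i4" "i4 < i5"
      "f i2 < 0" "f i3 > 0" "f i4 < 0" "f i5 > 0" by blast
    then show thesis using that[of i1 i2 i3 i4 i5] i1 True by simp
  next
    case False
    then have neg: "- f i1 > 0" using i1 by simp
    have "(\<Sum>i\<in>V. - f i * (c0 + c1 * t i + c2 * (t i)^2 + c3 * (t i)^3)) = 0" for c0 c1 c2 c3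
      using cubic[of c0 c1 c2 c3] by (simp add: sum_negf)
    from alternation_pos[OF fin mono this i1(1) neg]
    obtain i2 i3 i4 i5 where "{i2,i3,i4,i5} \<subseteq> V" "i1 < i2" "i2 < i3" "i3 < i4" "i4 < i5"
      "- f i2 < 0" "- f i3 > 0" "- f i4 < 0" "- f i5 > 0" using first by (metis neg_equal_0_iff_equal)
    then show thesis using that[of i1 i2 i3 i4 i5] i1 neg by simp
  qed
qed

text \<open>Both sets have five elements, so inclusion is equality and the sorted enumerations
  agree. This pins the sign pattern of a dependency on five given points.\<close>

lemma increasing_five_unique:
  fixes i1 i2 i3 i4 i5 v1 v2 v3 v4 v5 :: nat
  assumes "i1 < i2" "i2 < i3" "i3 < i4" "i4 < i5" "v1 < v2" "v2 < v3" "v3 < v4" "v4 < v5"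
    and sub: "{i1,i2,i3,i4,i5} \<subseteq> {v1,v2,v3,v4,v5}"
  shows "i1 = v1" "i2 = v2" "i3 = v3" "i4 = v4" "i5 = v5"
proof -
  have "{i1,i2,i3,i4,i5} = {v1,v2,v3,v4,v5}"
    by (rule card_subset_eq) (use assms in auto)
  then have "[i1,i2,i3,i4,i5] = [v1,v2,v3,v4,v5]"
    by (intro sorted_distinct_set_unique) (use assms in auto)
  then show "i1 = v1" "i2 = v2" "i3 = v3" "i4 = v4" "i5 = v5" by simp_all
qed

text \<open>The interleaving is the Radon partition of five points on the moment curve: the
  odd-ranked against the even-ranked ones.\<close>

definition pierced :: "nat set \<Rightarrow> nat set \<Rightarrow> bool" where
  "pierced A B \<longleftrightarrow> (\<exists>a x b y c. a < x \<and> x < b \<and> b < y \<and> y < c \<and> {a,b,c} \<subseteq> A \<and> {x,y} \<subseteq> B)"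

lemma piercedI:
  assumes "a < x" "x < b" "b < y" "y < c" "{a,b,c} \<subseteq> A" "{x,y} \<subseteq> B"
  shows "pierced A B"
  using assms unfolding pierced_def by blast

lemma piercedE:
  assumes "pierced A B"
  obtains a x b y c where "a < x" "x < b" "b < y" "y < c" "{a,b,c} \<subseteq> A" "{x,y} \<subseteq> B"
  using assms unfolding pierced_def by blast

lemma pierced_mono:
  assumes "pierced A B" "A \<subseteq> A'" "B \<subseteq> B'"
  shows "pierced A' B'"
  using assms(1)
proof (rule piercedE)
  fix a x b y c
  assume "a < x" "x < b" "b < y" "y < c" "{a,b,c} \<subseteq> A" "{x,y} \<subseteq> B"
  then show ?thesis by (intro piercedI[of a x b y c]) (use assms(2,3) in auto)
qed

text \<open>For points on the moment curve, \<open>above a b c d\<close> tells on which side of the plane through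
  the points \<open>a < b < c\<close> the point \<open>d\<close> lies.\<close>
definition above :: "nat \<Rightarrow> nat \<Rightarrow> nat \<Rightarrow> nat \<Rightarrow> bool" where
  "above a b c d \<longleftrightarrow> (a < d \<and> d < b) \<or> c < d"

section \<open>Convex hulls of points on the moment curve\<close>

locale moment_curve =
  fixes t :: "nat \<Rightarrow> real" and n :: nat
  assumes mono: "strict_mono_on {0..n+1} t"
begin

lemma inj_moment_pt: "inj_on (moment_pt t) {0..n+1}"
proof (rule inj_onI)
  fix i j assume ij: "i \<in> {0..n+1}" "j \<in> {0..n+1}" "moment_pt t i = moment_pt t j"
  then have "t i = t j" by (metis moment_pt_def vector_3(1))
  then show "i = j" using ij strict_mono_on_eqD[OF mono] by blast
qed

text \<open>Weights are indexed by labels rather than points, so that representations over different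
  label sets can be subtracted.\<close>

lemma conv_of_iff:
  assumes S: "S \<subseteq> {0..n+1}"
  shows "z \<in> conv_of t S \<longleftrightarrow>
    (\<exists>\<mu>. (\<forall>i\<in>S. \<mu> i \<ge> 0) \<and> sum \<mu> S = 1 \<and> (\<Sum>i\<in>S. \<mu> i *\<^sub>R moment_pt t i) = z)"
proof -
  have fin: "finite S" using S finite_subset by blast
  have inj: "inj_on (moment_pt t) S" using inj_moment_pt S inj_on_subset by blast
  show ?thesis
  proof
    assume "z \<in> conv_of t S"
    then obtain u where "\<forall>x\<in>moment_pt t ` S. u x \<ge> 0" "sum u (moment_pt t ` S) = 1"
      "(\<Sum>x\<in>moment_pt t ` S. u x *\<^sub>R x) = z"
      unfolding conv_of_def using fin by (auto simp: convex_hull_finite)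
    then show "\<exists>\<mu>. (\<forall>i\<in>S. \<mu> i \<ge> 0) \<and> sum \<mu> S = 1 \<and> (\<Sum>i\<in>S. \<mu> i *\<^sub>R moment_pt t i) = z"
      by (intro exI[of _ "\<lambda>i. u (moment_pt t i)"]) (simp add: sum.reindex[OF inj])
  next
    assume "\<exists>\<mu>. (\<forall>i\<in>S. \<mu> i \<ge> 0) \<and> sum \<mu> S = 1 \<and> (\<Sum>i\<in>S. \<mu> i *\<^sub>R moment_pt t i) = z"
    then obtain \<mu> where \<mu>: "\<forall>i\<in>S. \<mu> i \<ge> 0" "sum \<mu> S = 1" "(\<Sum>i\<in>S. \<mu> i *\<^sub>R moment_pt t i) = z"
      by blast
    have "(\<Sum>i\<in>S. \<mu> i *\<^sub>R moment_pt t i) \<in> convex hull (moment_pt t ` S)"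
      by (rule convex_sum[OF fin convex_convex_hull \<mu>(2)]) (use \<mu>(1) in \<open>auto intro: hull_inc\<close>)
    then show "z \<in> conv_of t S" unfolding conv_of_def \<mu>(3) .
  qed
qed

text \<open>The zero weight sum and the three coordinates of the vector equation make
  \<open>f\<close> orthogonal to 1, \<open>x\<close>, \<open>x^2\<close>, \<open>x^3\<close>, hence
  to every cubic.\<close>

lemma dependency_alternates:
  assumes V: "V \<subseteq> {0..n+1}" and s0: "sum f V = 0" and s1: "(\<Sum>i\<in>V. f i *\<^sub>R moment_pt t i) = 0"
    and nz: "\<exists>i\<in>V. f i \<noteq> 0"
  obtains i1 i2 i3 i4 i5 where "{i1,i2,i3,i4,i5} \<subseteq> V" "i1 < i2" "i2 < i3" "i3 < i4" "i4 < i5"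
    "(f i1 > 0 \<and> f i2 < 0 \<and> f i3 > 0 \<and> f i4 < 0 \<and> f i5 > 0) \<or>
     (f i1 < 0 \<and> f i2 > 0 \<and> f i3 < 0 \<and> f i4 > 0 \<and> f i5 < 0)"
proof -
  have comp: "(\<Sum>i\<in>V. f i * moment_pt t i $ k) = 0" for k
    using arg_cong[OF s1, of "\<lambda>v. v $ k"] by simp
  have "(\<Sum>i\<in>V. f i * t i) = 0" "(\<Sum>i\<in>V. f i * (t i)^2) = 0" "(\<Sum>i\<in>V. f i * (t i)^3) = 0"
    using comp[of 1] comp[of 2] comp[of 3] by (simp_all add: moment_pt_def vector_3)
  have cubic: "(\<Sum>i\<in>V. f i * (c0 + c1 * t i + c2 * (t i)^2 + c3 * (t i)^3)) = 0" for c0 c1 c2 c3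
  proof -
    have "(\<Sum>i\<in>V. f i * (c0 + c1 * t i + c2 * (t i)^2 + c3 * (t i)^3)) =
      c0 * (\<Sum>i\<in>V. f i) + c1 * (\<Sum>i\<in>V. f i * t i) + c2 * (\<Sum>i\<in>V. f i * (t i)^2)
       + c3 * (\<Sum>i\<in>V. f i * (t i)^3)"
      by (simp add: sum_distrib_left sum.distrib algebra_simps)
    then show ?thesis using s0 \<open>(\<Sum>i\<in>V. f i * t i) = 0\<close> \<open>(\<Sum>i\<in>V. f i * (t i)^2) = 0\<close>
      \<open>(\<Sum>i\<in>V. f i * (t i)^3) = 0\<close> by simp
  qed
  show thesis
    by (rule alternation[OF finite_subset[OF V finite_atLeastAtMost] monotone_on_subset[OF mono V] cubic nz that])
qed

lemma difference_dependency:
  assumes fin: "finite A" "finite B" and eq: "sum \<mu> A = sum \<nu> B"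
    "(\<Sum>i\<in>A. \<mu> i *\<^sub>R moment_pt t i) = (\<Sum>i\<in>B. \<nu> i *\<^sub>R moment_pt t i)"
  shows "(\<Sum>j\<in>A \<union> B. (if j \<in> A then \<mu> j else 0) - (if j \<in> B then \<nu> j else 0)) = 0" (is "?s0")
    and "(\<Sum>j\<in>A \<union> B. ((if j \<in> A then \<mu> j else 0) - (if j \<in> B then \<nu> j else 0)) *\<^sub>R moment_pt t j) = 0"
      (is "?s1")
proof -
  show ?s0
    using eq(1) fin by (simp add: sum_subtractf sum.If_cases Int_absorb1 Int_absorb2)
  have "(\<Sum>j\<in>A \<union> B. ((if j \<in> A then \<mu> j else 0) - (if j \<in> B then \<nu> j else 0)) *\<^sub>R moment_pt t j)
    = (\<Sum>j\<in>A \<union> B. (if j \<in> A then \<mu> j *\<^sub>R moment_pt t j else 0) - (if j \<in> B then \<nu> j *\<^sub>R moment_pt t j else 0))"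
    by (intro sum.cong) (auto simp: algebra_simps)
  then show ?s1
    using eq(2) fin by (simp add: sum_subtractf sum.If_cases Int_absorb1 Int_absorb2)
qed

text \<open>The difference of two representations of one point is a dependency that is positive only
  on \<open>A\<close> and negative only on \<open>B\<close>; five alternating signs would make one
  set pierce the other.\<close>

lemma weights_unique:
  assumes A: "A \<subseteq> {0..n+1}" and B: "B \<subseteq> {0..n+1}"
    and nc: "\<not> pierced A B" "\<not> pierced B A"
    and \<mu>: "\<forall>i\<in>A. \<mu> i \<ge> 0" "sum \<mu> A = 1" and \<nu>: "\<forall>i\<in>B. \<nu> i \<ge> 0" "sum \<nu> B = 1"
    and eq: "(\<Sum>i\<in>A. \<mu> i *\<^sub>R moment_pt t i) = (\<Sum>i\<in>B. \<nu> i *\<^sub>R moment_pt t i)"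
    and i: "i \<in> A \<union> B"
  shows "(if i \<in> A then \<mu> i else 0) = (if i \<in> B then \<nu> i else 0)"
proof (rule ccontr)
  assume ne: "\<not> ?thesis"
  define f where "f j = (if j \<in> A then \<mu> j else 0) - (if j \<in> B then \<nu> j else 0)" for j
  have fin: "finite A" "finite B" using A B finite_subset by blast+
  have eq1: "sum \<mu> A = sum \<nu> B" using \<mu> \<nu> by simp
  note s = difference_dependency[OF fin eq1 eq, folded f_def]
  have sub: "A \<union> B \<subseteq> {0..n+1}" using A B by simp
  have pos: "j \<in> A" if "f j > 0" for j using that \<nu> unfolding f_def by (auto split: if_splits)
  have neg: "j \<in> B" if "f j < 0" for j using that \<mu> unfolding f_def by (auto split: if_splits)
  have "\<exists>j\<in>A \<union> B. f j \<noteq> 0" using i ne unfolding f_def by (intro bexI[of _ i]) simp_all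
  from sub s this show False
  proof (rule dependency_alternates)
    fix i1 i2 i3 i4 i5
    assume ord: "i1 < i2" "i2 < i3" "i3 < i4" "i4 < i5"
      and "(f i1 > 0 \<and> f i2 < 0 \<and> f i3 > 0 \<and> f i4 < 0 \<and> f i5 > 0) \<or>
       (f i1 < 0 \<and> f i2 > 0 \<and> f i3 < 0 \<and> f i4 > 0 \<and> f i5 < 0)"
    then have "{i1,i3,i5} \<subseteq> A \<and> {i2,i4} \<subseteq> B \<or> {i1,i3,i5} \<subseteq> B \<and> {i2,i4} \<subseteq> A"
      by (elim disj_forward) (simp_all add: pos neg)
    then show False using nc piercedI[OF ord] by metis
  qed
qed

lemma conv_of_Int:
  assumes A: "A \<subseteq> {0..n+1}" and B: "B \<subseteq> {0..n+1}"
    and nc: "\<not> pierced A B" "\<not> pierced B A"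
  shows "conv_of t A \<inter> conv_of t B = conv_of t (A \<inter> B)"
proof
  show "conv_of t (A \<inter> B) \<subseteq> conv_of t A \<inter> conv_of t B"
    unfolding conv_of_def by (simp add: hull_mono image_mono)
next
  show "conv_of t A \<inter> conv_of t B \<subseteq> conv_of t (A \<inter> B)"
  proof
    fix z assume "z \<in> conv_of t A \<inter> conv_of t B"
    then obtain \<mu> \<nu> where \<mu>: "\<forall>i\<in>A. \<mu> i \<ge> 0" "sum \<mu> A = 1" "(\<Sum>i\<in>A. \<mu> i *\<^sub>R moment_pt t i) = z"
      and \<nu>: "\<forall>i\<in>B. \<nu> i \<ge> 0" "sum \<nu> B = 1" "(\<Sum>i\<in>B. \<nu> i *\<^sub>R moment_pt t i) = z"
      using conv_of_iff[OF A] conv_of_iff[OF B] by auto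
    have "(if i \<in> A then \<mu> i else 0) = (if i \<in> B then \<nu> i else 0)" if "i \<in> A \<union> B" for i
      by (rule weights_unique[OF A B nc \<mu>(1,2) \<nu>(1,2) _ that]) (simp add: \<mu> \<nu>)
    then have zero: "\<mu> i = 0" if "i \<in> A - B" for i using that by (metis DiffE UnI1)
    have fin: "finite A" using A finite_subset by blast
    have "sum \<mu> (A \<inter> B) = 1"
      using \<mu>(2) sum.mono_neutral_right[OF fin, of "A \<inter> B" \<mu>] zero by auto
    moreover have "(\<Sum>i\<in>A \<inter> B. \<mu> i *\<^sub>R moment_pt t i) = z"
      using \<mu>(3) sum.mono_neutral_right[OF fin, of "A \<inter> B" "\<lambda>i. \<mu> i *\<^sub>R moment_pt t i"] zero by auto
    moreover have "A \<inter> B \<subseteq> {0..n+1}" using A by blast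
    ultimately show "z \<in> conv_of t (A \<inter> B)"
      using \<mu>(1) conv_of_iff[of "A \<inter> B"] by blast
  qed
qed

text \<open>A singleton neither pierces nor is pierced, so its hull can only meet the hull of
  \<open>B\<close> in a common vertex.\<close>

lemma moment_pt_in_conv_of:
  assumes "B \<subseteq> {0..n+1}" "x \<in> {0..n+1}" "moment_pt t x \<in> conv_of t B"
  shows "x \<in> B"
proof (rule ccontr)
  assume x: "x \<notin> B"
  have "\<not> pierced {x} B" "\<not> pierced B {x}" unfolding pierced_def by auto
  then have "conv_of t {x} \<inter> conv_of t B = conv_of t ({x} \<inter> B)"
    using conv_of_Int[of "{x}" B] assms by auto
  then show False using x assms(3) by (simp add: conv_of_def)
qed

lemma five_point_signs:
  assumes v: "v1 < v2" "v2 < v3" "v3 < v4" "v4 < v5" "v5 \<le> n+1"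
    and f: "sum f {v1,v2,v3,v4,v5} = 0" "(\<Sum>i\<in>{v1,v2,v3,v4,v5}. f i *\<^sub>R moment_pt t i) = 0"
    and nz: "\<exists>i\<in>{v1,v2,v3,v4,v5}. f i \<noteq> 0"
  shows "(f v1 > 0 \<and> f v2 < 0 \<and> f v3 > 0 \<and> f v4 < 0 \<and> f v5 > 0) \<or>
     (f v1 < 0 \<and> f v2 > 0 \<and> f v3 < 0 \<and> f v4 > 0 \<and> f v5 < 0)"
proof -
  have V: "{v1,v2,v3,v4,v5} \<subseteq> {0..n+1}" using v by auto
  obtain i1 i2 i3 i4 i5 where
    i: "{i1,i2,i3,i4,i5} \<subseteq> {v1,v2,v3,v4,v5}" "i1 < i2" "i2 < i3" "i3 < i4" "i4 < i5"
    and sg: "(f i1 > 0 \<and> f i2 < 0 \<and> f i3 > 0 \<and> f i4 < 0 \<and> f i5 > 0) \<or>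
     (f i1 < 0 \<and> f i2 > 0 \<and> f i3 < 0 \<and> f i4 > 0 \<and> f i5 < 0)"
    by (rule dependency_alternates[OF V f nz])
  show ?thesis
    using sg unfolding increasing_five_unique[OF i(2-5) v(1-4) i(1)] .
qed

text \<open>Five points in dimension three are affinely dependent; replacing the dependency by its
  negative makes the first sign positive.\<close>

lemma radon:
  assumes v: "v1 < v2" "v2 < v3" "v3 < v4" "v4 < v5" "v5 \<le> n+1"
  obtains f where "f v1 > 0" "f v2 < 0" "f v3 > 0" "f v4 < 0" "f v5 > (0::real)"
    "sum f {v1,v2,v3,v4,v5} = 0" "(\<Sum>i\<in>{v1,v2,v3,v4,v5}. f i *\<^sub>R moment_pt t i) = 0"
proof -
  let ?V = "{v1,v2,v3,v4,v5}"
  have V: "?V \<subseteq> {0..n+1}" using v by auto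
  have inj: "inj_on (moment_pt t) ?V" by (rule inj_on_subset[OF inj_moment_pt V])
  have "card (moment_pt t ` ?V) = 5" using card_image[OF inj] v by simp
  then have "affine_dependent (moment_pt t ` ?V)"
    by (intro affine_dependent_biggerset) auto
  then obtain U where U: "sum U (moment_pt t ` ?V) = 0" "\<exists>v\<in>moment_pt t ` ?V. U v \<noteq> 0"
      "(\<Sum>v\<in>moment_pt t ` ?V. U v *\<^sub>R v) = 0"
    using affine_dependent_explicit_finite[of "moment_pt t ` ?V"] by auto
  define g where "g = U \<circ> moment_pt t"
  have g0: "sum g ?V = 0" using U(1) unfolding sum.reindex[OF inj] g_def by simp
  have g1: "(\<Sum>i\<in>?V. g i *\<^sub>R moment_pt t i) = 0"
    using U(3) unfolding sum.reindex[OF inj] g_def by (simp add: o_def)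
  have nz: "\<exists>i\<in>?V. g i \<noteq> 0" using U(2) unfolding g_def by auto
  note sg = five_point_signs[OF v g0 g1 nz]
  show thesis
  proof (cases "g v1 > 0")
    case True
    then show thesis using that[of g] g0 g1 sg by auto
  next
    case False
    have "sum (\<lambda>i. - g i) ?V = 0" "(\<Sum>i\<in>?V. (- g i) *\<^sub>R moment_pt t i) = 0"
      using g0 g1 by (simp_all only: sum_negf scaleR_minus_left neg_equal_0_iff_equal)
    then show thesis using False that[of "\<lambda>i. - g i"] sg by auto
  qed
qed

text \<open>The positive and the negative part of the Radon dependency, each divided by their common
  total \<open>d\<close>, represent the same point. It lies in the open segment, so a face
  containing it contains both endpoints.\<close>

lemma pierced_common_point:
  assumes v: "v1 < v2" "v2 < v3" "v3 < v4" "v4 < v5" "v5 \<le> n+1"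
  shows "\<exists>z \<in> conv_of t {v1,v3,v5}. z \<in> open_segment (moment_pt t v2) (moment_pt t v4)"
proof -
  obtain f where f: "f v1 > 0" "f v2 < 0" "f v3 > 0" "f v4 < 0" "f v5 > (0::real)"
    and s: "sum f {v1,v2,v3,v4,v5} = 0" "(\<Sum>i\<in>{v1,v2,v3,v4,v5}. f i *\<^sub>R moment_pt t i) = 0"
    using radon[OF v] .
  define d where "d = f v1 + f v3 + f v5"
  have d: "d > 0" using f unfolding d_def by simp
  have d2: "d = - f v2 - f v4" using s(1) v unfolding d_def by simp
  define z where "z = (f v1 / d) *\<^sub>R moment_pt t v1 + (f v3 / d) *\<^sub>R moment_pt t v3
    + (f v5 / d) *\<^sub>R moment_pt t v5"
  have "z \<in> conv_of t {v1,v3,v5}"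
    unfolding conv_of_iff[of "{v1,v3,v5}"] using v f d unfolding z_def
    by (subst conv_of_iff, force, intro exI[of _ "\<lambda>i. f i / d"])
      (auto simp: add_divide_distrib[symmetric] add.assoc d_def)
  have "d *\<^sub>R z = f v1 *\<^sub>R moment_pt t v1 + f v3 *\<^sub>R moment_pt t v3 + f v5 *\<^sub>R moment_pt t v5"
    unfolding z_def using d by (simp add: scaleR_add_right)
  also have "\<dots> = - f v2 *\<^sub>R moment_pt t v2 - f v4 *\<^sub>R moment_pt t v4"
    using s(2) v by (simp add: algebra_simps eq_neg_iff_add_eq_0)
  finally have dz: "d *\<^sub>R z = - f v2 *\<^sub>R moment_pt t v2 - f v4 *\<^sub>R moment_pt t v4" .
  have "z = inverse d *\<^sub>R (d *\<^sub>R z)" using d by simp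
  also have "\<dots> = (- f v2 / d) *\<^sub>R moment_pt t v2 + (- f v4 / d) *\<^sub>R moment_pt t v4"
    unfolding dz by (simp add: scaleR_diff_right divide_inverse mult.commute)
  also have "- f v2 / d = 1 - (- f v4 / d)" using d d2 by (simp add: field_simps)
  finally have "z = (1 - (- f v4 / d)) *\<^sub>R moment_pt t v2 + (- f v4 / d) *\<^sub>R moment_pt t v4" .
  moreover have "0 < - f v4 / d" "- f v4 / d < 1" using d d2 f by (auto simp: field_simps)
  moreover have "moment_pt t v2 \<noteq> moment_pt t v4"
    using inj_on_eq_iff[OF inj_moment_pt, of v2 v4] v by auto
  ultimately have "z \<in> open_segment (moment_pt t v2) (moment_pt t v4)"
    unfolding in_segment by blast
  with \<open>z \<in> conv_of t {v1,v3,v5}\<close> show ?thesis by blast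
qed

text \<open>A nontrivial dependency needs five indices for its alternating signs, and
  \<open>S\<close> has four.\<close>

lemma affine_independent_simplex:
  assumes S: "S \<subseteq> {0..n+1}" and card: "card S = 4"
  shows "\<not> affine_dependent (moment_pt t ` S)"
proof
  assume dep: "affine_dependent (moment_pt t ` S)"
  have fin: "finite S" using S finite_subset by blast
  have inj: "inj_on (moment_pt t) S" by (rule inj_on_subset[OF inj_moment_pt S])
  obtain U where U: "sum U (moment_pt t ` S) = 0" "\<exists>v\<in>moment_pt t ` S. U v \<noteq> 0"
      "(\<Sum>v\<in>moment_pt t ` S. U v *\<^sub>R v) = 0"
    using dep affine_dependent_explicit_finite[of "moment_pt t ` S"] fin by auto
  define g where "g = U \<circ> moment_pt t"
  have g0: "sum g S = 0" using U(1) unfolding sum.reindex[OF inj] g_def by simp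
  have g1: "(\<Sum>i\<in>S. g i *\<^sub>R moment_pt t i) = 0"
    using U(3) unfolding sum.reindex[OF inj] g_def by (simp add: o_def)
  have nz: "\<exists>i\<in>S. g i \<noteq> 0" using U(2) unfolding g_def by auto
  obtain i1 i2 i3 i4 i5 where
    i: "{i1,i2,i3,i4,i5} \<subseteq> S" "i1 < i2" "i2 < i3" "i3 < i4" "i4 < i5"
    by (rule dependency_alternates[OF S g0 g1 nz])
  have "card {i1,i2,i3,i4,i5} \<le> card S" by (rule card_mono[OF fin i(1)])
  then show False using i card by simp
qed

text \<open>If a triangle of \<open>A\<close> is pierced by an edge of \<open>B\<close>, the face
  property puts both ends of that edge into \<open>A\<close>, which then has five vertices. Without
  piercing, the intersection is the hull of the common vertices, and any set of vertices of an
  affinely independent simplex spans a face.\<close>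

lemma triangulation_iff:
  "is_triangulation t n T \<longleftrightarrow>
     (\<forall>S\<in>T. S \<subseteq> {0..n+1} \<and> card S = 4) \<and>
     (\<Union>S\<in>T. conv_of t S) = cyclic_polytope t n \<and>
     (\<forall>A\<in>T. \<forall>B\<in>T. \<not> pierced A B)" (is "?L \<longleftrightarrow> ?R")
proof
  assume L: ?L
  have "\<not> pierced A B" if AB: "A \<in> T" "B \<in> T" for A B
  proof
    assume "pierced A B"
    then obtain a x b y c where ord: "a < x" "x < b" "b < y" "y < c"
      and sub: "{a,b,c} \<subseteq> A" "{x,y} \<subseteq> B" by (rule piercedE)
    have A: "A \<subseteq> {0..n+1}" "card A = 4" and B: "B \<subseteq> {0..n+1}"
      using L AB unfolding is_triangulation_def by auto
    have "c \<le> n+1" using A sub by auto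
    then obtain z where z: "z \<in> conv_of t {a,b,c}" "z \<in> open_segment (moment_pt t x) (moment_pt t y)"
      using pierced_common_point[OF ord] by blast
    have xy: "moment_pt t x \<in> conv_of t B" "moment_pt t y \<in> conv_of t B"
      using sub unfolding conv_of_def by (auto intro: hull_inc)
    have "z \<in> conv_of t A" using z(1) sub unfolding conv_of_def
      by (meson hull_mono image_mono subsetD)
    moreover have "z \<in> conv_of t B"
    proof -
      have "closed_segment (moment_pt t x) (moment_pt t y) \<subseteq> conv_of t B"
        using xy unfolding conv_of_def by (intro closed_segment_subset) auto
      then show ?thesis using z(2) segment_open_subset_closed by blast
    qed
    moreover have "(conv_of t A \<inter> conv_of t B) face_of conv_of t B"
      using L AB unfolding is_triangulation_def by auto
    ultimately have "moment_pt t x \<in> conv_of t A" "moment_pt t y \<in> conv_of t A"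
      using face_ofD[OF _ z(2) _ _ _] xy by blast+
    moreover have "x \<in> {0..n+1}" "y \<in> {0..n+1}" using B sub by auto
    ultimately have "x \<in> A" "y \<in> A" using moment_pt_in_conv_of A(1) by blast+
    then have "{a,x,b,y,c} \<subseteq> A" using sub by auto
    moreover have "finite A" using A(2) by (metis card.infinite zero_neq_numeral)
    ultimately have "card {a,x,b,y,c} \<le> card A" by (intro card_mono)
    then show False using A(2) ord by simp
  qed
  then show ?R using L unfolding is_triangulation_def by simp
next
  assume R: ?R
  have "(conv_of t A \<inter> conv_of t B) face_of conv_of t A \<and>
    (conv_of t A \<inter> conv_of t B) face_of conv_of t B" if AB: "A \<in> T" "B \<in> T" for A B
  proof -
    have A: "A \<subseteq> {0..n+1}" "card A = 4" and B: "B \<subseteq> {0..n+1}" "card B = 4"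
      and nc: "\<not> pierced A B" "\<not> pierced B A" using R AB by simp_all
    have eq: "conv_of t A \<inter> conv_of t B = convex hull (moment_pt t ` (A \<inter> B))"
      using conv_of_Int[OF A(1) B(1) nc] unfolding conv_of_def .
    have "moment_pt t ` (A \<inter> B) \<subseteq> moment_pt t ` A" "moment_pt t ` (A \<inter> B) \<subseteq> moment_pt t ` B"
      by (simp_all add: image_mono)
    then show ?thesis
      unfolding eq unfolding conv_of_def
        face_of_convex_hull_affine_independent[OF affine_independent_simplex[OF A]]
        face_of_convex_hull_affine_independent[OF affine_independent_simplex[OF B]]
      by (metis (no_types))
  qed
  then show ?L using R unfolding is_triangulation_def by simp
qed

end

section \<open>Finding simplices from covered points\<close>

locale cyclic_triangulation = moment_curve +
  fixes T :: "nat set set"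
  assumes triang: "is_triangulation t n T"
begin

lemma simplex_subset: "S \<in> T \<Longrightarrow> S \<subseteq> {0..n+1}"
  and simplex_card: "S \<in> T \<Longrightarrow> card S = 4"
  and covers: "(\<Union>S\<in>T. conv_of t S) = cyclic_polytope t n"
  and not_pierced: "A \<in> T \<Longrightarrow> B \<in> T \<Longrightarrow> \<not> pierced A B"
  using triang triangulation_iff by auto

lemma finite_T: "finite T"
  by (rule finite_subset[of _ "Pow {0..n+1}"]) (use simplex_subset in auto)

text \<open>The simplex of \<open>T\<close> that covers the barycentre of \<open>A\<close> must have all of \<open>A\<close> among its vertices.\<close>
lemma exists_simplex_superset:
  assumes A: "A \<subseteq> {0..n+1}" "A \<noteq> {}"
    and nc: "\<And>B. B \<in> T \<Longrightarrow> \<not> pierced A B \<and> \<not> pierced B A"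
  shows "\<exists>B\<in>T. A \<subseteq> B"
proof -
  have fin: "finite A" using A finite_subset by blast
  define \<mu> :: "nat \<Rightarrow> real" where "\<mu> = (\<lambda>_. 1 / card A)"
  have \<mu>: "\<forall>i\<in>A. \<mu> i \<ge> 0" "sum \<mu> A = 1" and pos: "\<mu> i > 0" for i
    using fin A(2) unfolding \<mu>_def by (auto simp: card_gt_0_iff)
  define z where "z = (\<Sum>i\<in>A. \<mu> i *\<^sub>R moment_pt t i)"
  have "z \<in> conv_of t A" using conv_of_iff[OF A(1)] \<mu> z_def by blast
  then have "z \<in> cyclic_polytope t n" unfolding cyclic_polytope_def conv_of_def
    using A(1) hull_mono image_mono by (metis subsetD)
  then obtain B where B: "B \<in> T" "z \<in> conv_of t B" using covers by blast
  note Bs = simplex_subset[OF B(1)]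
  obtain \<nu> where \<nu>: "\<forall>i\<in>B. \<nu> i \<ge> 0" "sum \<nu> B = 1" "(\<Sum>i\<in>B. \<nu> i *\<^sub>R moment_pt t i) = z"
    using B(2) conv_of_iff[OF Bs] by blast
  have "A \<subseteq> B"
  proof
    fix i assume i: "i \<in> A"
    have "(if i \<in> A then \<mu> i else 0) = (if i \<in> B then \<nu> i else 0)"
      by (rule weights_unique[OF A(1) Bs _ _ \<mu> \<nu>(1,2)]) (use nc[OF B(1)] \<nu>(3) z_def i in auto)
    then show "i \<in> B" using i pos[of i] by (auto split: if_splits)
  qed
  then show ?thesis using B(1) by blast
qed

text \<open>In a dependency on five points, two coefficients agree in sign exactly when the plane
  through the other three points separates the two. With alternating signs this means ranks of equal
  parity.\<close>

lemma opposite_sides_same_sign: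
  assumes abc: "a < b" "b < c" "c \<le> n+1" and x: "x \<notin> {a,b,c}" "x \<le> n+1" and d: "d \<notin> {a,b,c}" "d \<le> n+1"
    and sides: "above a b c x \<noteq> above a b c d"
    and f: "sum f {a,b,c,x,d} = 0" "(\<Sum>i\<in>{a,b,c,x,d}. f i *\<^sub>R moment_pt t i) = 0"
    and fx: "f x > 0"
  shows "f d > 0"
proof -
  have *: "f d > 0" if v: "v1 < v2" "v2 < v3" "v3 < v4" "v4 < v5" "{a,b,c,x,d} = {v1,v2,v3,v4,v5}"
    and "{x,d} = {v1,v3} \<or> {x,d} = {v1,v5} \<or> {x,d} = {v3,v5} \<or> {x,d} = {v2,v4}" for v1 v2 v3 v4 v5
  proof -
    have "v5 \<in> {a,b,c,x,d}" using v(5) by blast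
    then have "v5 \<le> n+1" using abc x d by auto
    moreover have "\<exists>i\<in>{v1,v2,v3,v4,v5}. f i \<noteq> 0" using v(5) fx by (metis insertCI less_irrefl)
    ultimately show ?thesis
      using five_point_signs[OF v(1-4), of f] f that(6) fx unfolding v(5)
      by (auto simp: doubleton_eq_iff)
  qed
  have below: "y < a \<or> (b < y \<and> y < c)" if "\<not> above a b c y" "y \<notin> {a,b,c}" for y
    using that unfolding above_def by (simp, linarith)
  consider "x < a" "a < d" "d < b" | "x < a" "c < d" | "b < x" "x < c" "a < d" "d < b"
    | "b < x" "x < c" "c < d" | "d < a" "a < x" "x < b" | "d < a" "c < x"
    | "b < d" "d < c" "a < x" "x < b" | "b < d" "d < c" "c < x"
  proof (cases "above a b c x")
    case True
    with sides below[OF _ d(1)] show thesis using that unfolding above_def by metis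
  next
    case False
    with sides below[OF _ x(1)] show thesis using that unfolding above_def by metis
  qed
  then show ?thesis
  proof cases
    case 1 then show ?thesis using abc by (intro *[of x a d b c]) (simp_all add: insert_commute)
  next
    case 2 then show ?thesis using abc by (intro *[of x a b c d]) (simp_all add: insert_commute)
  next
    case 3 then show ?thesis using abc by (intro *[of a d b x c]) (simp_all add: insert_commute)
  next
    case 4 then show ?thesis using abc by (intro *[of a b x c d]) (simp_all add: insert_commute)
  next
    case 5 then show ?thesis using abc by (intro *[of d a x b c]) (simp_all add: insert_commute)
  next
    case 6 then show ?thesis using abc by (intro *[of d a b c x]) (simp_all add: insert_commute)
  next
    case 7 then show ?thesis using abc by (intro *[of a x b d c]) (simp_all add: insert_commute)
  next
    case 8 then show ?thesis using abc by (intro *[of a b d c x]) (simp_all add: insert_commute)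
  qed
qed

text \<open>Move the barycentre of the triangle slightly towards \<open>x\<close>: the simplex covering the moved
  point still contains the triangle, and its fourth vertex is on the side of \<open>x\<close>.\<close>
lemma apex_on_side:
  assumes abc: "a < b" "b < c" and B0: "B0 \<in> T" "{a,b,c} \<subseteq> B0"
    and x: "x \<le> n+1" "x \<notin> {a,b,c}"
  obtains d where "{a,b,c,d} \<in> T" "d \<notin> {a,b,c}" "above a b c d = above a b c x"
proof -
  let ?A = "{a,b,c}"
  have cn: "c \<le> n+1" using simplex_subset[OF B0(1)] B0(2) by auto
  have A: "?A \<subseteq> {0..n+1}" using abc cn by auto
  define \<mu>0 :: "nat \<Rightarrow> real" where "\<mu>0 = (\<lambda>_. 1/3)"
  define z0 where "z0 = (\<Sum>i\<in>?A. \<mu>0 i *\<^sub>R moment_pt t i)"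
  have \<mu>0: "\<forall>i\<in>?A. \<mu>0 i \<ge> 0" "sum \<mu>0 ?A = 1" using abc unfolding \<mu>0_def by auto
  \<comment> \<open>The simplices missing \<open>z0\<close> form a closed set, so any simplex
    covering a point close enough to \<open>z0\<close> contains \<open>z0\<close> itself.\<close>
  define K where "K = \<Union>(conv_of t ` {B\<in>T. z0 \<notin> conv_of t B})"
  have "closed K" unfolding K_def
  proof (rule closed_Union)
    show "finite (conv_of t ` {B \<in> T. z0 \<notin> conv_of t B})" using finite_T by simp
    show "\<forall>S\<in>conv_of t ` {B \<in> T. z0 \<notin> conv_of t B}. closed S"
    proof
      fix S assume "S \<in> conv_of t ` {B \<in> T. z0 \<notin> conv_of t B}"
      then obtain B where B: "B \<in> T" "S = conv_of t B" by blast
      have "finite B" using simplex_subset[OF B(1)] finite_subset by blast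
      then show "closed S" unfolding B(2) conv_of_def
        by (intro compact_imp_closed finite_imp_compact_convex_hull) simp
    qed
  qed
  moreover have "z0 \<notin> K" unfolding K_def by blast
  ultimately obtain e where e: "e > 0" "ball z0 e \<subseteq> - K"
    using open_contains_ball[of "- K"] by (auto simp: open_Compl)
  define m where "m = norm (moment_pt t x - z0)"
  \<comment> \<open>The summand 1 keeps \<epsilon> below 1 even when \<open>m = 0\<close>, while
    \<epsilon> times \<open>m\<close> stays below \<open>e\<close>.\<close>
  define \<epsilon> where "\<epsilon> = e / (e + 1 + m)"
  have m: "m \<ge> 0" unfolding m_def by simp
  have \<epsilon>: "0 < \<epsilon>" "\<epsilon> < 1" "\<epsilon> * m < e" using e m unfolding \<epsilon>_def by (auto simp: field_simps add_pos_pos add_pos_nonneg)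
  define z where "z = (1 - \<epsilon>) *\<^sub>R z0 + \<epsilon> *\<^sub>R moment_pt t x"
  have "z - z0 = \<epsilon> *\<^sub>R (moment_pt t x - z0)" unfolding z_def by (simp add: algebra_simps)
  then have "norm (z - z0) < e" using \<epsilon> unfolding m_def by simp
  then have "dist z0 z < e" by (metis dist_commute dist_norm)
  then have zK: "z \<notin> K" using e(2) by auto
  define \<mu> where "\<mu> = (\<lambda>i. if i = x then \<epsilon> else (1 - \<epsilon>) / 3)"
  have \<mu>: "\<forall>i\<in>insert x ?A. \<mu> i \<ge> 0" "sum \<mu> (insert x ?A) = 1"
    using \<epsilon> abc x unfolding \<mu>_def by (auto simp: field_simps)
  have \<mu>z: "(\<Sum>i\<in>insert x ?A. \<mu> i *\<^sub>R moment_pt t i) = z"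
    using abc x unfolding z_def z0_def \<mu>0_def \<mu>_def by (simp add: algebra_simps)
  have A': "insert x ?A \<subseteq> {0..n+1}" using A x by auto
  have "z \<in> conv_of t (insert x ?A)" using conv_of_iff[OF A'] \<mu> \<mu>z by blast
  then have "z \<in> cyclic_polytope t n" unfolding cyclic_polytope_def conv_of_def
    using A' hull_mono image_mono by (metis subsetD)
  then obtain B where B: "B \<in> T" "z \<in> conv_of t B" using covers by blast
  note Bs = simplex_subset[OF B(1)]
  have z0B: "z0 \<in> conv_of t B" using zK B unfolding K_def by blast
  obtain \<nu>0 where \<nu>0: "\<forall>i\<in>B. \<nu>0 i \<ge> 0" "sum \<nu>0 B = 1" "(\<Sum>i\<in>B. \<nu>0 i *\<^sub>R moment_pt t i) = z0"
    using z0B conv_of_iff[OF Bs] by blast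
  have nc: "\<not> pierced ?A B" "\<not> pierced B ?A"
    using not_pierced[OF B0(1) B(1)] not_pierced[OF B(1) B0(1)] pierced_mono B0(2) by blast+
  have sub: "?A \<subseteq> B"
  proof
    fix i assume i: "i \<in> ?A"
    have "(if i \<in> ?A then \<mu>0 i else 0) = (if i \<in> B then \<nu>0 i else 0)"
      by (rule weights_unique[OF A Bs nc \<mu>0 \<nu>0(1,2)]) (use \<nu>0(3) z0_def i in auto)
    then show "i \<in> B" using i unfolding \<mu>0_def by (auto split: if_splits)
  qed
  have "card (B - ?A) = 1"
    using sub simplex_card[OF B(1)] abc by (simp add: card_Diff_subset)
  then obtain d where "B - ?A = {d}" using card_1_singletonE by blast
  then have Bd: "B = {a,b,c,d}" "d \<notin> ?A" using sub by auto
  have "above a b c d = above a b c x"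
  proof (rule ccontr)
    assume ne: "above a b c d \<noteq> above a b c x"
    obtain \<nu> where \<nu>: "\<forall>i\<in>B. \<nu> i \<ge> 0" "sum \<nu> B = 1" "(\<Sum>i\<in>B. \<nu> i *\<^sub>R moment_pt t i) = z"
      using B(2) conv_of_iff[OF Bs] by blast
    \<comment> \<open>Subtracting the two representations of \<open>z\<close> gives a dependency
      that is positive at \<open>x\<close>. With \<open>d\<close> on the wrong side it would be
      positive at \<open>d\<close> too, where its value is minus a nonnegative weight.\<close>
    define f where "f j = (if j \<in> insert x ?A then \<mu> j else 0) - (if j \<in> B then \<nu> j else 0)" for j
    have fin: "finite (insert x ?A)" "finite B" using Bd by auto
    have eq: "sum \<mu> (insert x ?A) = sum \<nu> B"
      "(\<Sum>i\<in>insert x ?A. \<mu> i *\<^sub>R moment_pt t i) = (\<Sum>i\<in>B. \<nu> i *\<^sub>R moment_pt t i)"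
      using \<mu>(2) \<mu>z \<nu> by auto
    note s = difference_dependency[OF fin eq, folded f_def]
    have U: "insert x ?A \<union> B = {a,b,c,x,d}" using Bd by auto
    have xd: "x \<noteq> d" using ne by blast
    have "f x = \<epsilon>" using xd x Bd unfolding f_def \<mu>_def by auto
    then have fx: "f x > 0" using \<epsilon> by simp
    have "f d > 0"
      by (rule opposite_sides_same_sign[OF abc cn x(2,1) Bd(2) _ ne[symmetric] s[unfolded U] fx])
        (use Bs Bd in auto)
    moreover have "f d = - \<nu> d" using xd Bd unfolding f_def by auto
    ultimately show False using \<nu>(1) Bd by force
  qed
  then show thesis using that[of d] B(1) Bd by simp
qed

end

section \<open>Edges and triangles of a triangulation\<close>

definition edge_in :: "nat set set \<Rightarrow> nat \<Rightarrow> nat \<Rightarrow> bool" where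
  "edge_in T x y \<longleftrightarrow> x < y \<and> (\<exists>S\<in>T. {x,y} \<subseteq> S)"

definition triangle_in :: "nat set set \<Rightarrow> nat \<Rightarrow> nat \<Rightarrow> nat \<Rightarrow> bool" where
  "triangle_in T a b c \<longleftrightarrow> a < b \<and> b < c \<and> (\<exists>S\<in>T. {a,b,c} \<subseteq> S)"

lemma edgeI: "S \<in> T \<Longrightarrow> {x,y} \<subseteq> S \<Longrightarrow> x < y \<Longrightarrow> edge_in T x y"
  unfolding edge_in_def by blast

lemma triangleI: "S \<in> T \<Longrightarrow> {a,b,c} \<subseteq> S \<Longrightarrow> a < b \<Longrightarrow> b < c \<Longrightarrow> triangle_in T a b c"
  unfolding triangle_in_def by blast

lemma edge_less: "edge_in T x y \<Longrightarrow> x < y"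
  unfolding edge_in_def by blast

lemma triangle_edges:
  assumes "triangle_in T a b c"
  shows "edge_in T a b" "edge_in T b c" "edge_in T a c"
  using assms unfolding triangle_in_def edge_in_def by auto

context cyclic_triangulation
begin

lemma edge_le: "edge_in T x y \<Longrightarrow> y \<le> n+1"
  using simplex_subset unfolding edge_in_def by fastforce

lemma edge_not_piercing:
  assumes "edge_in T x y" "triangle_in T a b c"
  shows "\<not> (a < x \<and> x < b \<and> b < y \<and> y < c)"
proof
  assume o: "a < x \<and> x < b \<and> b < y \<and> y < c"
  obtain S R where "S \<in> T" "{x,y} \<subseteq> S" "R \<in> T" "{a,b,c} \<subseteq> R"
    using assms unfolding edge_in_def triangle_in_def by blast
  then show False using o piercedI[of a x b y c R S] not_pierced by blast
qed

text \<open>A pair contains no triangle, so it cannot be pierced itself; the only obstruction to a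
  simplex containing it is a triangle that it pierces.\<close>

lemma nonedge_pierces:
  assumes "x < y" "y \<le> n+1" "\<not> edge_in T x y"
  obtains a b c where "triangle_in T a b c" "a < x" "x < b" "b < y" "y < c"
proof -
  have "\<not> (\<exists>B\<in>T. {x,y} \<subseteq> B)" using assms unfolding edge_in_def by blast
  then obtain B where B: "B \<in> T" "pierced {x,y} B \<or> pierced B {x,y}"
    using exists_simplex_superset[of "{x,y}"] assms(1,2) by force
  have "\<not> pierced {x,y} B" by (auto elim!: piercedE)
  with B have "pierced B {x,y}" by blast
  then obtain a x' b y' c where o: "a < x'" "x' < b" "b < y'" "y' < c"
    and s: "{a,b,c} \<subseteq> B" "{x',y'} \<subseteq> {x,y}" by (rule piercedE)
  then have "x' = x" "y' = y" using assms(1) by auto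
  with o s show thesis using that triangleI[OF B(1) s(1)] by fastforce
qed

text \<open>Piercing requires labels below \<open>x\<close>, above \<open>y\<close> and strictly
  between them, and one of these places is empty.\<close>

lemma boundary_edge:
  assumes "x < y" "y \<le> n+1" "x = 0 \<or> y = n+1 \<or> y = Suc x"
  shows "edge_in T x y"
proof (rule ccontr)
  assume "\<not> ?thesis"
  then obtain a b c where tr: "triangle_in T a b c" and "a < x" "x < b" "b < y" "y < c"
    using nonedge_pierces assms by metis
  moreover have "c \<le> n+1" using edge_le triangle_edges(2)[OF tr] .
  ultimately show False using assms(3) by linarith
qed

text \<open>The middle vertex of a triangle pierced by \<open>ad\<close> is below \<open>c\<close>
  or above \<open>b\<close>, so \<open>ac\<close> or \<open>bd\<close> would pierce it as
  well.\<close>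

lemma crossing_edges:
  assumes ac: "edge_in T a c" and bd: "edge_in T b d" and ord: "a < b" "b < c" "c < d"
  shows "edge_in T a d"
proof (rule ccontr)
  assume ne: "\<not> ?thesis"
  have "a < d" using ord by simp
  then obtain p q r where tr: "triangle_in T p q r" and "p < a" "a < q" "q < d" "d < r"
    using nonedge_pierces[of a d] edge_le[OF bd] ne by metis
  then show False
    using edge_not_piercing[OF ac tr] edge_not_piercing[OF bd tr] ord by linarith
qed

text \<open>The largest \<open>q < y\<close> joined to \<open>x\<close> works. A triangle
  \<open>abc\<close> pierced by \<open>qy\<close> is also pierced by \<open>xy\<close> if
  \<open>a < x\<close>; otherwise \<open>xb\<close> is an edge, directly or by
  \<open>crossing_edges\<close>, against the choice of \<open>q\<close>.\<close>

lemma intermediate_vertex: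
  assumes xy: "edge_in T x y" and gap: "Suc x < y"
  obtains m where "edge_in T x m" "edge_in T m y"
proof -
  let ?Q = "{q. q < y \<and> edge_in T x q}"
  have fin: "finite ?Q" by simp
  have "Suc x \<in> ?Q" using boundary_edge[of x "Suc x"] gap edge_le[OF xy] by simp
  then have Q: "Max ?Q \<in> ?Q" using Max_in[OF fin] by blast
  define q where "q = Max ?Q"
  have q: "q < y" "edge_in T x q" using Q unfolding q_def by auto
  have max: "k \<le> q" if "k < y" "edge_in T x k" for k using that Max_ge[OF fin] unfolding q_def by blast
  have "edge_in T q y"
  proof (rule ccontr)
    assume "\<not> ?thesis"
    then obtain a b c where tr: "triangle_in T a b c" and o: "a < q" "q < b" "b < y" "y < c"
      using nonedge_pierces[of q y] q(1) edge_le[OF xy] by metis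
    have xq: "x < q" using q(2) edge_less by blast
    consider "a < x" | "a = x" | "x < a" by linarith
    then show False
    proof cases
      case 1 then show False using edge_not_piercing[OF xy tr] o xq by linarith
    next
      case 2 then show False using triangle_edges(1)[OF tr] max[of b] o by simp
    next
      case 3
      then have "edge_in T x b" using crossing_edges[OF q(2) triangle_edges(1)[OF tr]] o by simp
      then show False using max[of b] o by simp
    qed
  qed
  then show thesis using that q(2) by blast
qed

text \<open>The two conditions exclude piercing in both directions, so some simplex contains
  \<open>A\<close> and equals it by cardinality. As only edges are mentioned, the edges determine
  the triangulation.\<close>

lemma simplexI:
  assumes A: "A \<subseteq> {0..n+1}" "card A = 4"
    and edges: "\<And>x y. x \<in> A \<Longrightarrow> y \<in> A \<Longrightarrow> x < y \<Longrightarrow> edge_in T x y"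
    and np: "\<And>a b c x y. {a,b,c} \<subseteq> A \<Longrightarrow> edge_in T x y \<Longrightarrow> \<not> (a < x \<and> x < b \<and> b < y \<and> y < c)"
  shows "A \<in> T"
proof -
  have "A \<noteq> {}" using A(2) by force
  moreover have "\<not> pierced A B \<and> \<not> pierced B A" if "B \<in> T" for B
  proof (intro conjI notI)
    assume "pierced A B"
    then obtain a x b y c where o: "a < x" "x < b" "b < y" "y < c" "{a,b,c} \<subseteq> A" "{x,y} \<subseteq> B"
      by (rule piercedE)
    then show False using np[OF o(5) edgeI[OF that o(6)]] by linarith
  next
    assume "pierced B A"
    then obtain a x b y c where o: "a < x" "x < b" "b < y" "y < c" "{a,b,c} \<subseteq> B" "{x,y} \<subseteq> A"
      by (rule piercedE)
    then show False
      using edge_not_piercing[OF edges[of x y] triangleI[OF that o(5)]] by simp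
  qed
  ultimately obtain B where B: "B \<in> T" "A \<subseteq> B" using exists_simplex_superset A(1) by blast
  have "finite B" using simplex_subset[OF B(1)] finite_subset by blast
  then have "A = B" using card_subset_eq B simplex_card[OF B(1)] A(2) by metis
  then show ?thesis using B by simp
qed

end

lemma triangulation_subset_if_edges_eq:
  assumes "cyclic_triangulation t n T" "cyclic_triangulation t n T'" and eq: "edge_in T = edge_in T'"
  shows "T \<subseteq> T'"
proof
  interpret T: cyclic_triangulation t n T by fact
  interpret T': cyclic_triangulation t n T' by fact
  fix A assume A: "A \<in> T"
  show "A \<in> T'"
  proof (rule T'.simplexI)
    show "A \<subseteq> {0..n+1}" "card A = 4" using T.simplex_subset T.simplex_card A by auto
    show "edge_in T' x y" if "x \<in> A" "y \<in> A" "x < y" for x y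
      unfolding eq[symmetric] using edgeI[OF A] that by simp
    show "\<not> (a < x \<and> x < b \<and> b < y \<and> y < c)" if "{a,b,c} \<subseteq> A" "edge_in T' x y" for a b c x y
      using T.edge_not_piercing[of x y a b c] that triangleI[OF A that(1)] eq by auto
  qed
qed

lemma triangulation_eq_if_edges_eq:
  assumes "cyclic_triangulation t n T" "cyclic_triangulation t n T'" and "edge_in T = edge_in T'"
  shows "T = T'"
  using triangulation_subset_if_edges_eq[of t n] assms by (metis subset_antisym)

section \<open>Flips\<close>

text \<open>These are the four-element subsets omitting a vertex of odd rank; those in
  \<open>upper_tets\<close> omit one of even rank.\<close>

definition lower_tets :: "nat \<Rightarrow> nat \<Rightarrow> nat \<Rightarrow> nat \<Rightarrow> nat \<Rightarrow> nat set set" where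
  "lower_tets v1 v2 v3 v4 v5 = {{v1,v2,v4,v5},{v1,v2,v3,v4},{v2,v3,v4,v5}}"

definition upper_tets :: "nat \<Rightarrow> nat \<Rightarrow> nat \<Rightarrow> nat \<Rightarrow> nat \<Rightarrow> nat set set" where
  "upper_tets v1 v2 v3 v4 v5 = {{v1,v2,v3,v5},{v1,v3,v4,v5}}"

text \<open>A shortest edge \<open>xy\<close> of \<open>T\<close> missing in \<open>T'\<close> has a vertex \<open>m\<close> that is the middle vertex of every
  triangle of \<open>T'\<close> pierced by \<open>xy\<close>. Among these triangles \<open>{a,m,c}\<close>, one with \<open>c\<close> maximal and then
  \<open>a\<close> minimal has its two apexes \<open>u\<close>, \<open>w\<close> between \<open>a\<close> and \<open>m\<close> and between \<open>m\<close> and \<open>c\<close>.\<close>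
lemma flippable_triangle_exists:
  assumes "cyclic_triangulation t n T" "cyclic_triangulation t n T'"
    and sub: "\<And>x y. edge_in T' x y \<Longrightarrow> edge_in T x y" and ne: "\<exists>x y. edge_in T x y \<and> \<not> edge_in T' x y"
  obtains v1 v2 v3 v4 v5 where "v1 < v2" "v2 < v3" "v3 < v4" "v4 < v5"
    "upper_tets v1 v2 v3 v4 v5 \<subseteq> T'" "edge_in T v2 v4"
proof -
  interpret T: cyclic_triangulation t n T by fact
  interpret T': cyclic_triangulation t n T' by fact
  define D where "D x y \<longleftrightarrow> edge_in T x y \<and> \<not> edge_in T' x y" for x y
  obtain x y where xy: "D x y" and least: "\<And>x' y'. D x' y' \<Longrightarrow> y - x \<le> y' - x'"
  proof -
    have "\<exists>p. D (fst p) (snd p)" using ne unfolding D_def by auto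
    then show thesis using that
      ex_has_least_nat[of "\<lambda>p. D (fst p) (snd p)" _ "\<lambda>p. snd p - fst p"] by (metis fst_conv snd_conv)
  qed
  have e: "edge_in T x y" "\<not> edge_in T' x y" and "x < y" "y \<le> n+1"
    using xy T.edge_le edge_less unfolding D_def by auto
  then obtain a0 b0 c0 where tr0: "triangle_in T' a0 b0 c0" "a0 < x" "x < b0" "b0 < y" "y < c0"
    using T'.nonedge_pierces by metis
  then obtain m where m: "edge_in T x m" "edge_in T m y" using T.intermediate_vertex[OF e(1)] by force
  have xm: "x < m" "m < y" using m edge_less by auto
  \<comment> \<open>Both parts are shorter than \<open>xy\<close>, so by minimality neither is
    missing in \<open>T'\<close>.\<close>
  have m': "edge_in T' x m" "edge_in T' m y"
    using least[of x m] least[of m y] m xm unfolding D_def by fastforce+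
  \<comment> \<open>If \<open>b < m\<close> then \<open>xm\<close> pierces the triangle, if
    \<open>m < b\<close> then \<open>my\<close> does.\<close>
  have unique: "b = m" if "triangle_in T' a b c" "a < x" "x < b" "b < y" "y < c" for a b c
    using T'.edge_not_piercing[OF m'(1) that(1)] T'.edge_not_piercing[OF m'(2) that(1)] that xm
    by linarith
  let ?C = "{c. y < c \<and> (\<exists>a<x. triangle_in T' a m c)}"
  have finC: "finite ?C"
    by (rule finite_subset[of _ "{..n+1}"]) (auto dest!: triangle_edges(2) T'.edge_le)
  have "c0 \<in> ?C" using tr0 unique[OF tr0] by blast
  then have "Max ?C \<in> ?C" using Max_in[OF finC] by blast
  define c where "c = Max ?C"
  have c: "y < c" "\<exists>a<x. triangle_in T' a m c" using \<open>Max ?C \<in> ?C\<close> unfolding c_def by auto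
  have cmax: "c' \<le> c" if "triangle_in T' a m c'" "a < x" "y < c'" for a c'
    using that Max_ge[OF finC] unfolding c_def by blast
  define a where "a = (LEAST a. a < x \<and> triangle_in T' a m c)"
  have a: "a < x" "triangle_in T' a m c" using LeastI_ex[OF c(2)] unfolding a_def by auto
  have amin: "a \<le> a'" if "triangle_in T' a' m c" "a' < x" for a'
    using that unfolding a_def by (intro Least_le) simp
  obtain B where B: "B \<in> T'" "{a,m,c} \<subseteq> B" using a(2) unfolding triangle_in_def by blast
  have ord: "a < m" "m < c" using a(2) unfolding triangle_in_def by auto
  have xn: "x \<le> n+1" "x \<notin> {a,m,c}" and yn: "y \<le> n+1" "y \<notin> {a,m,c}"
    using \<open>x < y\<close> \<open>y \<le> n+1\<close> xm c a by auto
  \<comment> \<open>\<open>x\<close> and \<open>y\<close> lie on opposite sides of the triangle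
    \<open>a m c\<close>, so it has an apex on each side.\<close>
  obtain u where u: "{a,m,c,u} \<in> T'" "u \<notin> {a,m,c}" "above a m c u"
    using T'.apex_on_side[OF ord B xn] a xm unfolding above_def by auto
  obtain w where w: "{a,m,c,w} \<in> T'" "w \<notin> {a,m,c}" "\<not> above a m c w"
    using T'.apex_on_side[OF ord B yn] a xm c unfolding above_def by auto
  have "\<not> c < u"
  proof
    assume "c < u"
    then have "triangle_in T' a m u" using ord by (intro triangleI[OF u(1)]) auto
    then show False using cmax[of a u] a c \<open>c < u\<close> by simp
  qed
  then have u1: "a < u" "u < m" using u(3) unfolding above_def by auto
  have "\<not> w < a"
  proof
    assume "w < a"
    then have "triangle_in T' w m c" using ord by (intro triangleI[OF w(1)]) auto
    then show False using amin[of w] a \<open>w < a\<close> by simp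
  qed
  then have w1: "m < w" "w < c" using w(2,3) unfolding above_def by auto
  \<comment> \<open>Otherwise \<open>xy\<close> pierces \<open>a u c\<close>, whose middle vertex is
    not \<open>m\<close>; the bound on \<open>w\<close> is symmetric.\<close>
  have "u \<le> x"
  proof (rule ccontr)
    assume "\<not> ?thesis"
    moreover have "triangle_in T' a u c" using u1 ord by (intro triangleI[OF u(1)]) auto
    ultimately show False using unique[of a u c] a c u1 xm by simp
  qed
  have "y \<le> w"
  proof (rule ccontr)
    assume "\<not> ?thesis"
    moreover have "triangle_in T' a w c" using w1 ord by (intro triangleI[OF w(1)]) auto
    ultimately show False using unique[of a w c] a c w1 xm by simp
  qed
  have um: "edge_in T u m" using sub edgeI[OF u(1), of u m] u1 by simp
  have mw: "edge_in T m w" using sub edgeI[OF w(1), of m w] w1 by simp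
  \<comment> \<open>Crossing \<open>um\<close> with \<open>xy\<close> stretches the edge to
    \<open>uy\<close>, and crossing that with \<open>mw\<close> stretches it to \<open>uw\<close>,
    the edge to be inserted.\<close>
  have "edge_in T u y"
  proof (cases "u = x")
    case False
    then show ?thesis using T.crossing_edges[OF um e(1)] \<open>u \<le> x\<close> xm by simp
  qed (use e in simp)
  then have "edge_in T u w"
  proof (cases "w = y")
    case False
    then show ?thesis using T.crossing_edges[OF \<open>edge_in T u y\<close> mw] \<open>y \<le> w\<close> xm u1 by simp
  qed (use \<open>edge_in T u y\<close> in simp)
  moreover have "{a,u,m,c} \<in> T'" "{a,m,w,c} \<in> T'" using u(1) w(1) by (simp_all add: insert_commute)
  ultimately show thesis using that[of a u m w c] u1 w1 unfolding upper_tets_def by simp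
qed

lemma lower_tets_pair:
  assumes "{x,y} \<subseteq> {v1,v2,v3,v4,v5}"
  shows "\<exists>S\<in>lower_tets v1 v2 v3 v4 v5. {x,y} \<subseteq> S"
  using assms unfolding lower_tets_def by auto

lemma upper_tets_pair:
  assumes "{x,y} \<subseteq> {v1,v2,v3,v4,v5}" "x < y" "v1 < v2" "v2 < v3" "v3 < v4" "v4 < v5"
  shows "(\<exists>S\<in>upper_tets v1 v2 v3 v4 v5. {x,y} \<subseteq> S) \<or> (x = v2 \<and> y = v4)"
  using assms unfolding upper_tets_def by auto

lemma lower_tets_subset: "S \<in> lower_tets v1 v2 v3 v4 v5 \<Longrightarrow> S \<subseteq> {v1,v2,v3,v4,v5}"
  unfolding lower_tets_def by auto

lemma upper_tets_subset: "S \<in> upper_tets v1 v2 v3 v4 v5 \<Longrightarrow> S \<subseteq> {v1,v2,v3,v4,v5}"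
  unfolding upper_tets_def by auto

lemma increasing_triple:
  fixes a b c p q r s :: nat
  assumes "a < b" "b < c" and sub: "{a,b,c} \<subseteq> {p,q,r,s}" and pqrs: "p < q" "q < r" "r < s"
  shows "(a = p \<and> b = q \<and> c = r) \<or> (a = p \<and> b = q \<and> c = s)
    \<or> (a = p \<and> b = r \<and> c = s) \<or> (a = q \<and> b = r \<and> c = s)"
proof -
  have "a = p \<or> a = q \<or> a = r \<or> a = s" "b = p \<or> b = q \<or> b = r \<or> b = s"
    "c = p \<or> c = q \<or> c = r \<or> c = s" using sub by simp_all
  then show ?thesis using assms(1,2) pqrs by (elim disjE) simp_all
qed

text \<open>The triangles of the lower tetrahedra are those already in an upper one and the three
  containing both \<open>v2\<close> and \<open>v4\<close>.\<close>

lemma lower_tets_triple: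
  assumes "S \<in> lower_tets v1 v2 v3 v4 v5" "{a,b,c} \<subseteq> S" "a < b" "b < c"
    and v: "v1 < v2" "v2 < v3" "v3 < v4" "v4 < v5"
  shows "{a,b,c} \<subseteq> {v1,v2,v3,v5} \<or> {a,b,c} \<subseteq> {v1,v3,v4,v5} \<or> (a = v1 \<and> b = v2 \<and> c = v4)
    \<or> (a = v2 \<and> b = v3 \<and> c = v4) \<or> (a = v2 \<and> b = v4 \<and> c = v5)"
proof -
  consider "S = {v1,v2,v4,v5}" | "S = {v1,v2,v3,v4}" | "S = {v2,v3,v4,v5}" using assms(1)
    unfolding lower_tets_def by auto
  then show ?thesis
  proof cases
    case 1
    with increasing_triple[of a b c v1 v2 v4 v5] assms(2-) show ?thesis by auto
  next
    case 2
    with increasing_triple[of a b c v1 v2 v3 v4] assms(2-) show ?thesis by auto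
  next
    case 3
    with increasing_triple[of a b c v2 v3 v4 v5] assms(2-) show ?thesis by auto
  qed
qed

context moment_curve
begin

text \<open>The exchange step of Caratheodory's theorem: subtract the multiple of \<open>f\<close>
  given by the least ratio of weight to positive coefficient. All weights stay nonnegative and the
  one at the minimiser vanishes.\<close>

lemma conv_of_remove:
  assumes S: "S \<subseteq> {0..n+1}" and z: "z \<in> conv_of t S"
    and f: "sum f S = 0" "(\<Sum>i\<in>S. f i *\<^sub>R moment_pt t i) = 0" and pos: "\<exists>i\<in>S. f i > 0"
  shows "\<exists>i\<in>S. f i > 0 \<and> z \<in> conv_of t (S - {i})"
proof -
  have fin: "finite S" using S finite_subset by blast
  obtain \<mu> where \<mu>: "\<forall>i\<in>S. \<mu> i \<ge> 0" "sum \<mu> S = 1" "(\<Sum>i\<in>S. \<mu> i *\<^sub>R moment_pt t i) = z"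
    using z conv_of_iff[OF S] by blast
  let ?P = "{i\<in>S. f i > 0}"
  obtain k where k: "k \<in> ?P" "\<And>i. i \<in> ?P \<Longrightarrow> \<mu> k / f k \<le> \<mu> i / f i"
  proof -
    have "finite ?P" "?P \<noteq> {}" using fin pos by auto
    from ex_is_arg_min_if_finite[OF this, of "\<lambda>i. \<mu> i / f i"] show thesis
      using that by (auto simp: is_arg_min_linorder)
  qed
  define c where "c = \<mu> k / f k"
  have c: "c \<ge> 0" using k(1) \<mu>(1) unfolding c_def by simp
  define \<nu> where "\<nu> = (\<lambda>i. \<mu> i - c * f i)"
  have \<nu>k: "\<nu> k = 0" using k(1) unfolding \<nu>_def c_def by simp
  have "\<nu> i \<ge> 0" if "i \<in> S" for i
  proof (cases "f i > 0")
    case True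
    then show ?thesis using k(2)[of i] that unfolding \<nu>_def c_def[symmetric] by (simp add: field_simps)
  next
    case False
    then have "c * f i \<le> 0" using c by (simp add: mult_nonneg_nonpos)
    moreover have "\<mu> i \<ge> 0" using \<mu>(1) that by blast
    ultimately show ?thesis unfolding \<nu>_def by linarith
  qed
  moreover have "sum \<nu> (S - {k}) = 1"
  proof -
    have "sum \<nu> S = 1" using \<mu>(2) f(1) unfolding \<nu>_def by (simp add: sum_subtractf sum_distrib_left[symmetric])
    then show ?thesis using sum.remove[OF fin, of k \<nu>] k(1) \<nu>k by simp
  qed
  moreover have "(\<Sum>i\<in>S - {k}. \<nu> i *\<^sub>R moment_pt t i) = z"
  proof -
    have "(\<Sum>i\<in>S. \<nu> i *\<^sub>R moment_pt t i) = z - c *\<^sub>R (\<Sum>i\<in>S. f i *\<^sub>R moment_pt t i)"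
      using \<mu>(3) unfolding \<nu>_def by (simp add: scaleR_diff_left sum_subtractf scaleR_sum_right)
    then show ?thesis
      using f(2) sum.remove[OF fin, of k "\<lambda>i. \<nu> i *\<^sub>R moment_pt t i"] k(1) \<nu>k by simp
  qed
  moreover have "S - {k} \<subseteq> {0..n+1}" using S by blast
  ultimately have "z \<in> conv_of t (S - {k})" using conv_of_iff[of "S - {k}"] by blast
  then show ?thesis using k(1) by blast
qed

text \<open>The Radon dependency is positive exactly at the odd ranks, and dropping such a vertex
  leaves a lower tetrahedron.\<close>

lemma lower_tets_cover:
  assumes v: "v1 < v2" "v2 < v3" "v3 < v4" "v4 < v5" "v5 \<le> n+1"
  shows "conv_of t {v1,v2,v3,v4,v5} \<subseteq> (\<Union>S\<in>lower_tets v1 v2 v3 v4 v5. conv_of t S)"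
proof
  fix z assume z: "z \<in> conv_of t {v1,v2,v3,v4,v5}"
  obtain f where f: "f v1 > 0" "f v2 < 0" "f v3 > 0" "f v4 < 0" "f v5 > (0::real)"
    and s: "sum f {v1,v2,v3,v4,v5} = 0" "(\<Sum>i\<in>{v1,v2,v3,v4,v5}. f i *\<^sub>R moment_pt t i) = 0"
    using radon[OF v] .
  have "{v1,v2,v3,v4,v5} \<subseteq> {0..n+1}" using v by auto
  then obtain i where i: "i \<in> {v1,v2,v3,v4,v5}" "f i > 0" "z \<in> conv_of t ({v1,v2,v3,v4,v5} - {i})"
    using conv_of_remove[OF _ z s] f(1) by blast
  then consider "i = v1" | "i = v3" | "i = v5" using f by force
  then show "z \<in> (\<Union>S\<in>lower_tets v1 v2 v3 v4 v5. conv_of t S)"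
  proof cases
    case 1
    then have "{v1,v2,v3,v4,v5} - {i} = {v2,v3,v4,v5}" using v by auto
    then show ?thesis using i(3) unfolding lower_tets_def by auto
  next
    case 2
    then have "{v1,v2,v3,v4,v5} - {i} = {v1,v2,v4,v5}" using v by auto
    then show ?thesis using i(3) unfolding lower_tets_def by auto
  next
    case 3
    then have "{v1,v2,v3,v4,v5} - {i} = {v1,v2,v3,v4}" using v by auto
    then show ?thesis using i(3) unfolding lower_tets_def by auto
  qed
qed

end

section \<open>The down-flip on five vertices\<close>

locale upper_flippable = cyclic_triangulation +
  fixes v1 v2 v3 v4 v5 :: nat
  assumes ord: "v1 < v2" "v2 < v3" "v3 < v4" "v4 < v5"
    and upper: "upper_tets v1 v2 v3 v4 v5 \<subseteq> T"
begin

abbreviation "flipped \<equiv> (T - upper_tets v1 v2 v3 v4 v5) \<union> lower_tets v1 v2 v3 v4 v5"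

lemma v5_le: "v5 \<le> n+1"
  using upper simplex_subset[of "{v1,v3,v4,v5}"] unfolding upper_tets_def by simp

lemma upper_edge:
  assumes "{x,y} \<subseteq> {v1,v2,v3,v4,v5}" "x < y" "x \<noteq> v2 \<or> y \<noteq> v4"
  shows "edge_in T x y"
proof -
  obtain S where "S \<in> T" "{x,y} \<subseteq> S"
    using upper_tets_pair[OF assms(1,2) ord] upper assms(3) by blast
  then show ?thesis using edgeI assms(2) by blast
qed

lemma upper_triangle:
  assumes "{a,b,c} \<subseteq> {v1,v2,v3,v5} \<or> {a,b,c} \<subseteq> {v1,v3,v4,v5}" "a < b" "b < c"
  shows "triangle_in T a b c"
proof -
  have "{v1,v2,v3,v5} \<in> T" "{v1,v3,v4,v5} \<in> T" using upper unfolding upper_tets_def by simp_all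
  then show ?thesis using assms triangleI by metis
qed

lemma not_edge_v2_v4: "\<not> edge_in T v2 v4"
  using edge_not_piercing[of v2 v4 v1 v3 v5] upper_triangle[of v1 v3 v5] ord by auto

lemma lower_disjoint: "S \<in> lower_tets v1 v2 v3 v4 v5 \<Longrightarrow> S \<notin> T"
proof
  assume S: "S \<in> lower_tets v1 v2 v3 v4 v5" "S \<in> T"
  then have "{v2,v4} \<subseteq> S" unfolding lower_tets_def by auto
  then show False using not_edge_v2_v4 edgeI[OF S(2)] ord by simp
qed

text \<open>The old edges and triangles on the five vertices leave no room: a triangle pierced by
  \<open>v2 v4\<close> must be \<open>v1 v3 v5\<close>, and its only tetrahedra are the two upper
  ones.\<close>

lemma pierced_by_new_edge:
  assumes A: "A \<in> T" and s: "{p,q,r} \<subseteq> A" and o: "p < v2" "v2 < q" "q < v4" "v4 < r"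
  shows "A \<in> upper_tets v1 v2 v3 v4 v5"
proof -
  have tr: "triangle_in T p q r" using triangleI[OF A s] o by simp
  note tri = edge_not_piercing[OF _ tr] and e = triangle_edges[OF tr]
  have "\<not> p < v1" using tri[OF upper_edge[of v1 v4]] ord o by force
  moreover have "\<not> v1 < p"
    using edge_not_piercing[OF e(1) upper_triangle[of v1 v2 v5]] ord o by force
  ultimately have p: "p = v1" by simp
  have "\<not> v5 < r" using tri[OF upper_edge[of v2 v5]] ord o by force
  moreover have "\<not> r < v5"
    using edge_not_piercing[OF e(2) upper_triangle[of v1 v4 v5]] ord o by force
  ultimately have r: "r = v5" by simp
  have "\<not> q < v3" using tri[OF upper_edge[of v2 v3]] ord o by force
  moreover have "\<not> v3 < q" using tri[OF upper_edge[of v3 v4]] ord o by force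
  ultimately have q: "q = v3" by simp
  have sub: "{v1,v3,v5} \<subseteq> A" using s p q r by simp
  have "card (A - {v1,v3,v5}) = 1"
    using sub simplex_card[OF A] ord by (simp add: card_Diff_subset)
  then obtain s where "A - {v1,v3,v5} = {s}" using card_1_singletonE by blast
  then have As: "A = {v1,v3,v5,s}" "s \<notin> {v1,v3,v5}" using sub by auto
  have trA: "triangle_in T a b c" if "{a,b,c} \<subseteq> {v1,v3,v5,s}" "a < b" "b < c" for a b c
    using triangleI[OF A _ that(2,3)] that(1) As by simp
  have eA: "edge_in T a b" if "{a,b} \<subseteq> {v1,v3,v5,s}" "a < b" for a b
    using edgeI[OF A _ that(2)] that(1) As by simp
  \<comment> \<open>One forbidden piercing for each of the six open intervals cut out by the five
    labels.\<close>
  have "\<not> s < v1" using edge_not_piercing[OF upper_edge[of v1 v4] trA[of s v3 v5]] ord by force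
  moreover have "\<not> (v1 < s \<and> s < v2)"
    using edge_not_piercing[OF eA[of s v3] upper_triangle[of v1 v2 v5]] ord by force
  moreover have "\<not> (v2 < s \<and> s < v3)"
    using edge_not_piercing[OF upper_edge[of v2 v3] trA[of v1 s v5]] ord by force
  moreover have "\<not> (v3 < s \<and> s < v4)"
    using edge_not_piercing[OF upper_edge[of v3 v4] trA[of v1 s v5]] ord by force
  moreover have "\<not> (v4 < s \<and> s < v5)"
    using edge_not_piercing[OF eA[of v3 s] upper_triangle[of v1 v4 v5]] ord by force
  moreover have "\<not> v5 < s"
    using edge_not_piercing[OF upper_edge[of v2 v5] trA[of v1 v3 s]] ord by force
  ultimately have "s = v2 \<or> s = v4" using As(2) ord by (simp, linarith)
  then show ?thesis using As(1) unfolding upper_tets_def by (auto simp: insert_commute)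
qed

text \<open>A triangle containing \<open>v2\<close> and \<open>v4\<close> becomes an old one when
  \<open>v4\<close> is moved out to \<open>v5\<close> or \<open>v2\<close> to \<open>v1\<close>, and
  this preserves piercing.\<close>

lemma lower_triangle_not_pierced:
  assumes S: "S \<in> lower_tets v1 v2 v3 v4 v5" "{a,b,c} \<subseteq> S" and o: "a < x" "x < b" "b < y" "y < c"
  shows "\<not> edge_in T x y"
proof
  assume e: "edge_in T x y"
  have np: "\<not> (a < x \<and> x < b \<and> b < y \<and> y < c)"
    if "{a,b,c} \<subseteq> {v1,v2,v3,v5} \<or> {a,b,c} \<subseteq> {v1,v3,v4,v5}" "a < b" "b < c" for a b c
    using edge_not_piercing[OF e upper_triangle[OF that]] .
  have abc: "a < b" "b < c" using o by simp_all
  from lower_tets_triple[OF S abc ord]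
  consider "{a,b,c} \<subseteq> {v1,v2,v3,v5} \<or> {a,b,c} \<subseteq> {v1,v3,v4,v5}" | "a = v1" "b = v2" "c = v4"
    | "a = v2" "b = v3" "c = v4" | "a = v2" "b = v4" "c = v5" by metis
  then show False
  proof cases
    case 1 then show False using np[OF _ abc] o by simp
  next
    case 2 then show False using np[of v1 v2 v5] o ord by simp
  next
    case 3 then show False using np[of v2 v3 v5] o ord by simp
  next
    case 4 then show False using np[of v1 v4 v5] o ord by simp
  qed
qed

lemma edge_in_flipped: "edge_in flipped x y \<longleftrightarrow> edge_in T x y \<or> (x = v2 \<and> y = v4)"
proof
  assume "edge_in flipped x y"
  then obtain S where S: "S \<in> flipped" "{x,y} \<subseteq> S" "x < y" unfolding edge_in_def by blast
  show "edge_in T x y \<or> (x = v2 \<and> y = v4)"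
  proof (cases "S \<in> T")
    case True then show ?thesis using edgeI S by blast
  next
    case False
    then have "{x,y} \<subseteq> {v1,v2,v3,v4,v5}" using S lower_tets_subset by blast
    then show ?thesis using upper_edge S(3) by blast
  qed
next
  have new: "edge_in flipped x y" if "{x,y} \<subseteq> {v1,v2,v3,v4,v5}" "x < y" for x y
    using lower_tets_pair[OF that(1)] that(2) unfolding edge_in_def by blast
  assume "edge_in T x y \<or> (x = v2 \<and> y = v4)"
  then show "edge_in flipped x y"
  proof
    assume "edge_in T x y"
    then obtain S where S: "S \<in> T" "{x,y} \<subseteq> S" "x < y" unfolding edge_in_def by blast
    show ?thesis
    proof (cases "S \<in> upper_tets v1 v2 v3 v4 v5")
      case True
      then have "{x,y} \<subseteq> {v1,v2,v3,v4,v5}" using S(2) upper_tets_subset by blast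
      then show ?thesis using new S(3) by blast
    next
      case False then show ?thesis using S unfolding edge_in_def by blast
    qed
  next
    assume "x = v2 \<and> y = v4"
    then show ?thesis using new[of v2 v4] ord by simp
  qed
qed

lemma flipped_not_pierced:
  assumes A: "A \<in> flipped" and B: "B \<in> flipped"
  shows "\<not> pierced A B"
proof
  assume "pierced A B"
  then obtain a x b y c where o: "a < x" "x < b" "b < y" "y < c"
    and s: "{a,b,c} \<subseteq> A" "{x,y} \<subseteq> B" by (rule piercedE)
  have xy: "x < y" using o by simp
  show False
  proof (cases "A \<in> T")
    case True
    then have A': "A \<notin> upper_tets v1 v2 v3 v4 v5" using A lower_disjoint by blast
    have "edge_in T x y \<or> (x = v2 \<and> y = v4)" using edgeI[OF B s(2) xy] edge_in_flipped by blast
    then show False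
    proof
      assume "edge_in T x y"
      then show False
        using edge_not_piercing[OF _ triangleI[OF True s(1)]] o by simp
    next
      assume "x = v2 \<and> y = v4"
      then show False using pierced_by_new_edge[OF True s(1)] o A' by simp
    qed
  next
    case False
    then have A': "A \<in> lower_tets v1 v2 v3 v4 v5" using A by blast
    show False
    proof (cases "edge_in T x y")
      case True
      then show False using lower_triangle_not_pierced[OF A' s(1) o] by blast
    next
      case False
      \<comment> \<open>The new edge could only pierce \<open>v1 v3 v5\<close> here, the one triple
        of the five labels that lies in no lower tetrahedron.\<close>
      then have "x = v2" "y = v4" using edgeI[OF B s(2) xy] edge_in_flipped by blast+
      moreover have "{a,b,c} \<subseteq> {v1,v2,v3,v4,v5}"
        using lower_tets_subset[OF A'] s(1) by blast
      ultimately have "{a,x,b,y,c} \<subseteq> {v1,v2,v3,v4,v5}" by simp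
      from increasing_five_unique[OF o ord this] have "{v1,v3,v5} \<subseteq> A" using s(1) by simp
      then show False using A' ord unfolding lower_tets_def by auto
    qed
  qed
qed

lemma flipped_simplex:
  assumes "S \<in> flipped"
  shows "S \<subseteq> {0..n+1} \<and> card S = 4"
proof (cases "S \<in> T")
  case True
  then show ?thesis using simplex_subset simplex_card by blast
next
  case False
  then show ?thesis using assms v5_le ord unfolding lower_tets_def by auto
qed

lemma flipped_covers: "(\<Union>S\<in>flipped. conv_of t S) = cyclic_polytope t n"
proof
  have "S \<subseteq> {0..n+1}" if "S \<in> flipped" for S
    using that flipped_simplex by blast
  then show "(\<Union>S\<in>flipped. conv_of t S) \<subseteq> cyclic_polytope t n"
    unfolding cyclic_polytope_def conv_of_def by (intro UN_least hull_mono image_mono)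
next
  have "conv_of t S \<subseteq> (\<Union>S\<in>flipped. conv_of t S)" if "S \<in> T" for S
  proof (cases "S \<in> upper_tets v1 v2 v3 v4 v5")
    case True
    then have "S \<subseteq> {v1,v2,v3,v4,v5}" by (rule upper_tets_subset)
    then have "conv_of t S \<subseteq> conv_of t {v1,v2,v3,v4,v5}"
      unfolding conv_of_def by (intro hull_mono image_mono)
    then show ?thesis using lower_tets_cover[OF ord v5_le] by blast
  next
    case False then show ?thesis using that by blast
  qed
  then show "cyclic_polytope t n \<subseteq> (\<Union>S\<in>flipped. conv_of t S)"
    unfolding covers[symmetric] by blast
qed

lemma flipped_triangulation: "is_triangulation t n flipped"
  unfolding triangulation_iff by (intro conjI ballI flipped_simplex flipped_covers flipped_not_pierced)

lemma up_flip_flipped: "up_flip t n flipped T"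
proof -
  have "T = (flipped - lower_tets v1 v2 v3 v4 v5) \<union> upper_tets v1 v2 v3 v4 v5"
    using upper lower_disjoint by blast
  then show ?thesis
    unfolding up_flip_def lower_tets_def[symmetric] upper_tets_def[symmetric]
    using flipped_triangulation ord by blast
qed

end

section \<open>The graph of internal edges\<close>

context cyclic_triangulation
begin

lemma Gamma_edges_iff:
  assumes "x < y"
  shows "{x,y} \<in> Gamma_edges n T \<longleftrightarrow> edge_in T x y \<and> 1 \<le> x \<and> y \<le> n"
  using assms unfolding Gamma_edges_def F1_def edge_in_def by auto

end

lemma Gamma_edgesE:
  assumes "e \<in> Gamma_edges n T"
  obtains x y where "e = {x,y}" "x < y"
proof -
  have "card e = 2" using assms unfolding Gamma_edges_def F1_def by simp
  then obtain x y where "e = {x,y}" "x \<noteq> y" by (auto simp: card_2_iff)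
  then show thesis using that by (metis insert_commute linorder_neqE_nat)
qed

text \<open>A pair involving \<open>0\<close> or \<open>n+1\<close> is an edge of every
  triangulation, so restricting to \<open>[n]\<close> loses nothing.\<close>

lemma Gamma_subset_iff_edges_subset:
  assumes "cyclic_triangulation t n T" "cyclic_triangulation t n T'"
  shows "Gamma_edges n T' \<subseteq> Gamma_edges n T \<longleftrightarrow> (\<forall>x y. edge_in T' x y \<longrightarrow> edge_in T x y)"
proof -
  interpret T: cyclic_triangulation t n T by fact
  interpret T': cyclic_triangulation t n T' by fact
  show ?thesis
  proof
    assume sub: "Gamma_edges n T' \<subseteq> Gamma_edges n T"
    have "edge_in T x y" if e: "edge_in T' x y" for x y
    proof (cases "1 \<le> x \<and> y \<le> n")
      case True
      then show ?thesis using T.Gamma_edges_iff T'.Gamma_edges_iff sub e edge_less[OF e] by blast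
    next
      case False
      then have "x = 0 \<or> y = n + 1" using T'.edge_le[OF e] by linarith
      then show ?thesis using T.boundary_edge edge_less[OF e] T'.edge_le[OF e] by blast
    qed
    then show "\<forall>x y. edge_in T' x y \<longrightarrow> edge_in T x y" by blast
  next
    assume sub: "\<forall>x y. edge_in T' x y \<longrightarrow> edge_in T x y"
    show "Gamma_edges n T' \<subseteq> Gamma_edges n T"
    proof
      fix e assume e: "e \<in> Gamma_edges n T'"
      then obtain x y where "e = {x,y}" "x < y" by (rule Gamma_edgesE)
      then show "e \<in> Gamma_edges n T" using e sub T.Gamma_edges_iff T'.Gamma_edges_iff by blast
    qed
  qed
qed

section \<open>Flip sequences and missing edges\<close>

definition edge_diff :: "nat set set \<Rightarrow> nat set set \<Rightarrow> (nat \<times> nat) set" where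
  "edge_diff T T' = {(x,y). edge_in T x y \<and> \<not> edge_in T' x y}"

text \<open>The number of flips is kept exact so that a single missing edge yields a single flip.
  \<open>T\<close> stays fixed and \<open>T'\<close> is flipped down towards it, so each flip found
  becomes the last one of the chain.\<close>

lemma flips_from_edges_subset:
  assumes T: "cyclic_triangulation t n T" and "cyclic_triangulation t n T'"
    and "\<And>x y. edge_in T' x y \<Longrightarrow> edge_in T x y"
  shows "(up_flip t n ^^ card (edge_diff T T')) T T'"
  using assms(2,3)
proof (induction "card (edge_diff T T')" arbitrary: T')
  case 0
  interpret T: cyclic_triangulation t n T by fact
  have "edge_diff T T' \<subseteq> {..n+1} \<times> {..n+1}"
    unfolding edge_diff_def using T.edge_le edge_less by fastforce
  then have "finite (edge_diff T T')" using finite_subset by blast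
  then have "edge_diff T T' = {}" using 0 by simp
  then have "edge_in T = edge_in T'" using 0(3) unfolding edge_diff_def by blast
  then have "T = T'" using triangulation_eq_if_edges_eq[OF T 0(2)] by simp
  then show ?case using 0(1) by simp
next
  case (Suc k)
  have "edge_diff T T' \<noteq> {}" using Suc(2) by force
  then have ex: "\<exists>x y. edge_in T x y \<and> \<not> edge_in T' x y" unfolding edge_diff_def by blast
  obtain v1 v2 v3 v4 v5 where v: "v1 < v2" "v2 < v3" "v3 < v4" "v4 < v5"
    "upper_tets v1 v2 v3 v4 v5 \<subseteq> T'" "edge_in T v2 v4"
    by (rule flippable_triangle_exists[OF T Suc(3) _ ex]) (use Suc(4) in blast)
  interpret U: upper_flippable t n T' v1 v2 v3 v4 v5
    by (intro upper_flippable.intro Suc(3) upper_flippable_axioms.intro v)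
  have tri: "cyclic_triangulation t n U.flipped"
    by (intro cyclic_triangulation.intro cyclic_triangulation_axioms.intro U.moment_curve_axioms U.flipped_triangulation)
  have "edge_diff T U.flipped = edge_diff T T' - {(v2,v4)}"
    unfolding edge_diff_def U.edge_in_flipped by auto
  moreover have "(v2,v4) \<in> edge_diff T T'" using v(6) U.not_edge_v2_v4 unfolding edge_diff_def by simp
  ultimately have card: "k = card (edge_diff T U.flipped)" using Suc(2) by simp
  have "(up_flip t n ^^ card (edge_diff T U.flipped)) T U.flipped"
    by (rule Suc(1)[OF card tri]) (use U.edge_in_flipped Suc(4) v(6) in blast)
  then have "(up_flip t n ^^ Suc k) T T'"
    unfolding card[symmetric] using U.up_flip_flipped by (rule relpowp_Suc_I)
  then show ?case using Suc(2) by simp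
qed

lemma up_flip_edges:
  assumes "cyclic_triangulation t n T'" and flip: "up_flip t n T T'"
  obtains x y where "1 \<le> x" "x < y" "y \<le> n" "\<not> edge_in T' x y"
    "\<And>p q. edge_in T p q \<longleftrightarrow> edge_in T' p q \<or> (p = x \<and> q = y)"
proof -
  interpret T': cyclic_triangulation t n T' by fact
  obtain v1 v2 v3 v4 v5 where v: "v1 < v2" "v2 < v3" "v3 < v4" "v4 < v5"
    and low: "lower_tets v1 v2 v3 v4 v5 \<subseteq> T"
    and T': "T' = (T - lower_tets v1 v2 v3 v4 v5) \<union> upper_tets v1 v2 v3 v4 v5"
    using flip unfolding up_flip_def lower_tets_def upper_tets_def by blast
  interpret T: cyclic_triangulation t n T
    using flip unfolding up_flip_def by unfold_locales blast
  interpret U: upper_flippable t n T' v1 v2 v3 v4 v5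
    by unfold_locales (use v T' in auto)
  \<comment> \<open>Needed for the down-flip of \<open>T'\<close> to give back \<open>T\<close>: an
    upper tetrahedron contains \<open>v1 v3 v5\<close>, pierced by the edge \<open>v2 v4\<close> of
    \<open>T\<close>.\<close>
  have "S \<notin> T" if "S \<in> upper_tets v1 v2 v3 v4 v5" for S
  proof
    assume "S \<in> T"
    have "{v1,v3,v5} \<subseteq> S" using that unfolding upper_tets_def by auto
    moreover have "{v1,v2,v4,v5} \<in> T" using low unfolding lower_tets_def by simp
    ultimately show False
      using piercedI[OF v, of S "{v1,v2,v4,v5}"] T.not_pierced \<open>S \<in> T\<close> by simp
  qed
  then have "T = U.flipped" using T' low by blast
  then have "edge_in T p q \<longleftrightarrow> edge_in T' p q \<or> (p = v2 \<and> q = v4)" for p q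
    using U.edge_in_flipped[of p q] by simp
  then show thesis
    using that[of v2 v4] v U.v5_le U.not_edge_v2_v4 by simp
qed

text \<open>The induction prepends flips: \<open>up_flip\<close> guarantees that its source is a
  triangulation, and the target is one by the induction hypothesis.\<close>

lemma le1_imp_Gamma_subset:
  assumes "cyclic_triangulation t n T'" and "le1 t n T T'"
  shows "Gamma_edges n T' \<subseteq> Gamma_edges n T"
proof -
  interpret T': cyclic_triangulation t n T' by fact
  have "cyclic_triangulation t n T \<and> Gamma_edges n T' \<subseteq> Gamma_edges n T"
    using assms(2) unfolding le1_def
  proof (induction rule: converse_rtranclp_induct)
    case base
    then show ?case using assms(1) by simp
  next
    case (step S S')
    have S: "cyclic_triangulation t n S"
      using step(1) T'.mono unfolding up_flip_def by unfold_locales auto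
    have S': "cyclic_triangulation t n S'" using step by blast
    obtain x y where "\<And>p q. edge_in S p q \<longleftrightarrow> edge_in S' p q \<or> (p = x \<and> q = y)"
      using up_flip_edges[OF S' step(1)] by metis
    then have "Gamma_edges n S' \<subseteq> Gamma_edges n S"
      using Gamma_subset_iff_edges_subset[OF S S'] by blast
    then show ?case using S step by blast
  qed
  then show ?thesis by blast
qed

lemma up_flip_iff_Gamma:
  assumes "cyclic_triangulation t n T" "cyclic_triangulation t n T'"
  shows "up_flip t n T T' \<longleftrightarrow>
    (\<exists>e \<in> Gamma_edges n T - Gamma_edges n T'. Gamma_edges n T = Gamma_edges n T' \<union> {e})"
proof
  interpret T: cyclic_triangulation t n T by fact
  interpret T': cyclic_triangulation t n T' by fact
  {
    assume flip: "up_flip t n T T'"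
    obtain x y where xy: "1 \<le> x" "x < y" "y \<le> n" "\<not> edge_in T' x y"
      and edges: "\<And>p q. edge_in T p q \<longleftrightarrow> edge_in T' p q \<or> (p = x \<and> q = y)"
      by (rule up_flip_edges[OF assms(2) flip]) blast
    have new: "{x,y} \<in> Gamma_edges n T" "{x,y} \<notin> Gamma_edges n T'"
      using T.Gamma_edges_iff[OF xy(2)] T'.Gamma_edges_iff[OF xy(2)] xy edges by auto
    have "e \<in> Gamma_edges n T' \<union> {{x,y}}" if e: "e \<in> Gamma_edges n T" for e
    proof -
      obtain p q where pq: "e = {p,q}" "p < q" using e by (rule Gamma_edgesE)
      then show ?thesis
        using e edges T.Gamma_edges_iff[OF pq(2)] T'.Gamma_edges_iff[OF pq(2)] by auto
    qed
    moreover have "Gamma_edges n T' \<subseteq> Gamma_edges n T"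
      using Gamma_subset_iff_edges_subset[OF assms] edges by blast
    ultimately have "Gamma_edges n T = Gamma_edges n T' \<union> {{x,y}}" using new by blast
    then show "\<exists>e \<in> Gamma_edges n T - Gamma_edges n T'. Gamma_edges n T = Gamma_edges n T' \<union> {e}"
      using new by blast
  next
    assume "\<exists>e \<in> Gamma_edges n T - Gamma_edges n T'. Gamma_edges n T = Gamma_edges n T' \<union> {e}"
    then obtain e where e: "e \<in> Gamma_edges n T" "e \<notin> Gamma_edges n T'"
      and eq: "Gamma_edges n T = Gamma_edges n T' \<union> {e}" by blast
    then have sub: "edge_in T p q" if "edge_in T' p q" for p q
      using Gamma_subset_iff_edges_subset[OF assms] that by blast
    obtain x y where xy: "e = {x,y}" "x < y" using e(1) by (rule Gamma_edgesE)
    \<comment> \<open>A pair missing in \<open>T'\<close> is not a boundary pair, so it lies inside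
      \<open>[n]\<close> and must be the one additional edge of the graph.\<close>
    have only: "(p,q) = (x,y)" if pq: "edge_in T p q" "\<not> edge_in T' p q" for p q
    proof -
      have "p < q" using edge_less[OF pq(1)] .
      moreover have "q \<le> n+1" using T.edge_le[OF pq(1)] .
      moreover from calculation have "\<not> (p = 0 \<or> q = n + 1 \<or> q = Suc p)"
        using T'.boundary_edge[of p q] pq(2) by blast
      ultimately have "1 \<le> p \<and> q \<le> n" by linarith
      then have "{p,q} = {x,y}"
        using T.Gamma_edges_iff[OF \<open>p < q\<close>] T'.Gamma_edges_iff[OF \<open>p < q\<close>] pq eq xy(1) by blast
      then show ?thesis using \<open>p < q\<close> xy(2) by (auto simp: doubleton_eq_iff)
    qed
    have "edge_in T x y" "\<not> edge_in T' x y"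
      using e xy T.Gamma_edges_iff[OF xy(2)] T'.Gamma_edges_iff[OF xy(2)] by auto
    then have "(x,y) \<in> edge_diff T T'" unfolding edge_diff_def by simp
    moreover have "edge_diff T T' \<subseteq> {(x,y)}"
    proof
      fix z assume "z \<in> edge_diff T T'"
      then obtain p q where z: "z = (p,q)" "edge_in T p q" "\<not> edge_in T' p q"
        unfolding edge_diff_def by blast
      show "z \<in> {(x,y)}" unfolding z(1) only[OF z(2,3)] by simp
    qed
    ultimately have "edge_diff T T' = {(x,y)}" by blast
    moreover have "(up_flip t n ^^ card (edge_diff T T')) T T'"
      by (rule flips_from_edges_subset[OF assms]) (rule sub)
    ultimately show "up_flip t n T T'" by (simp add: eq_OO)
  }
qed

theorem theorem14:
  fixes n :: nat and t :: "nat \<Rightarrow> real" and T T' :: "nat set set"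
  assumes "n \<ge> 2"
    and "strict_mono_on {0..n+1} t"
    and "is_triangulation t n T" and "is_triangulation t n T'"
  shows "(up_flip t n T T' \<longleftrightarrow>
            (\<exists>e \<in> Gamma_edges n T - Gamma_edges n T'.
               Gamma_edges n T = Gamma_edges n T' \<union> {e}))
       \<and> (le1 t n T T' \<longleftrightarrow> Gamma_edges n T' \<subseteq> Gamma_edges n T)"
proof -
  have T: "cyclic_triangulation t n T" and T': "cyclic_triangulation t n T'"
    using assms(2-4) by (unfold_locales, simp_all)
  have "le1 t n T T'" if "Gamma_edges n T' \<subseteq> Gamma_edges n T"
    using flips_from_edges_subset[OF T T'] that Gamma_subset_iff_edges_subset[OF T T']
    unfolding le1_def by (blast intro: relpowp_imp_rtranclp)
  then show ?thesis using up_flip_iff_Gamma[OF T T'] le1_imp_Gamma_subset[OF T'] by blast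
qed

end
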